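(* Let $d\ge1$ and $m\ge2d+1$. For any triangulation $S$ of the cyclic polytope $C(m,2d)$, the set $e(S)$ consists of exactly $\binom{m-d-1}{d}$ elements of $\mathbf I^d_m$, and is non-intertwining.
   Context: $C(m,2d)\subset\mathbb R^{2d}$ is the convex hull of $p_1,\dots,p_m$ with $p_t=(t,t^2,\dots,t^{2d})$. A triangulation of $C(m,2d)$ is a subdivision of it into $2d$-dimensional simplices (any two meeting in a common, possibly empty, face) whose vertices are vertices of $C(m,2d)$. A $d$-simplex in $C(m,2d)$ is the convex hull of $d+1$ vertices, recorded as the increasing $(d+1)$-tuple of their indices from $\{1,\dots,m\}$. Lower facets of $C(m,2d)$ are the facets dividing $C(m,2d)$ from the points below it with respect to the $2d$-th coordinate. For a triangulation $S$, $e(S)$ is the set of $d$-simplices in $C(m,2d)$ which appear as a face of some simplex in $S$ and which do not lie on any lower boundary facet of $C(m,2d)$. $\mathbf I^d_m=\{(i_0,\dots,i_d)\in\{1,\dots,m\}^{d+1}\mid i_x+2\le i_{x+1}\text{ for all }0\le x\le d-1\}$. For increasing $(d+1)$-tuples $X=(x_0,\dots,x_d)$, $Y=(y_0,\dots,y_d)$, $X$ intertwines $Y$ if $x_0<y_0<x_1<y_1<\cdots<x_d<y_d$. A collection of increasing $(d+1)$-tuples is non-intertwining if no pair of its elements intertwine (in either order). *)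

theory Defs
  imports "HOL-Analysis.Analysis"
begin

text \<open>
  Euclidean space of dimension \<open>2 * d\<close> is \<open>real ^ 'n\<close>, where a bijection
  \<open>c :: 'n \<Rightarrow> nat\<close> from \<open>UNIV\<close> to \<open>{1..2 * d}\<close> numbers the coordinates: coordinate number
  \<open>k\<close> of \<open>x\<close> is \<open>x $ i\<close> for the index \<open>i\<close> with \<open>c i = k\<close>.
\<close>

definition moment_point :: "('n::finite \<Rightarrow> nat) \<Rightarrow> nat \<Rightarrow> real ^ 'n" where
  "moment_point c t = (\<chi> i. real t ^ c i)"

definition cyclic_polytope :: "('n::finite \<Rightarrow> nat) \<Rightarrow> nat \<Rightarrow> (real ^ 'n) set" where
  "cyclic_polytope c m = convex hull (moment_point c ` {1..m})"

text \<open>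
  The library's \<^const>\<open>triangulation\<close> is a finite family of simplices of arbitrary, possibly
  mixed, dimension that meet pairwise in common faces.
\<close>

definition polytope_triangulation :: "nat \<Rightarrow> 'a::euclidean_space set \<Rightarrow> 'a set set \<Rightarrow> bool" where
  "polytope_triangulation n P S \<longleftrightarrow>
     triangulation S \<and> \<Union>S = P \<and>
     (\<forall>T\<in>S. int n simplex T \<and> {v. v extreme_point_of T} \<subseteq> {v. v extreme_point_of P})"

definition below :: "('n::finite \<Rightarrow> nat) \<Rightarrow> nat \<Rightarrow> real ^ 'n \<Rightarrow> real ^ 'n \<Rightarrow> bool" where
  "below c k y x \<longleftrightarrow> (\<forall>i. if c i = k then y $ i < x $ i else y $ i = x $ i)"

text \<open>
  A facet is lower if it separates the polytope from the points below it, that is, if no point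
  vertically below a point of the facet belongs to the polytope. Vertical facets are not lower.
\<close>

definition lower_facet :: "('n::finite \<Rightarrow> nat) \<Rightarrow> nat \<Rightarrow> (real ^ 'n) set \<Rightarrow> (real ^ 'n) set \<Rightarrow> bool" where
  "lower_facet c k P F \<longleftrightarrow> F facet_of P \<and> (\<forall>x\<in>F. \<forall>y. below c k y x \<longrightarrow> y \<notin> P)"

text \<open>
  Tuples are lists, indexed from \<open>0\<close>; the \<open>d\<close>-simplex recorded by the list \<open>xs\<close> is the convex
  hull of \<open>moment_point c ` set xs\<close>.
\<close>

definition increasing_tuples :: "nat \<Rightarrow> nat \<Rightarrow> nat list set" where
  "increasing_tuples d m = {xs. length xs = d + 1 \<and> set xs \<subseteq> {1..m} \<and> sorted_wrt (<) xs}"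

definition e_simplices :: "('n::finite \<Rightarrow> nat) \<Rightarrow> nat \<Rightarrow> nat \<Rightarrow> (real ^ 'n) set set \<Rightarrow> nat list set" where
  "e_simplices c d m S =
     {xs \<in> increasing_tuples d m.
        (\<exists>T\<in>S. convex hull (moment_point c ` set xs) face_of T) \<and>
        \<not> (\<exists>F. lower_facet c (2 * d) (cyclic_polytope c m) F \<and>
               convex hull (moment_point c ` set xs) \<subseteq> F)}"

definition I_tuples :: "nat \<Rightarrow> nat \<Rightarrow> nat list set" where
  "I_tuples d m =
     {xs. length xs = d + 1 \<and> set xs \<subseteq> {1..m} \<and> (\<forall>j<d. xs ! j + 2 \<le> xs ! (j + 1))}"

definition intertwines :: "nat \<Rightarrow> nat list \<Rightarrow> nat list \<Rightarrow> bool" where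
  "intertwines d X Y \<longleftrightarrow> (\<forall>j\<le>d. X ! j < Y ! j) \<and> (\<forall>j<d. Y ! j < X ! (j + 1))"

definition non_intertwining :: "nat \<Rightarrow> nat list set \<Rightarrow> bool" where
  "non_intertwining d A \<longleftrightarrow> (\<forall>X\<in>A. \<forall>Y\<in>A. \<not> intertwines d X Y)"

end

theory Submission
  imports Defs "HOL-Computational_Algebra.Polynomial"
begin

text \<open>
  Write a simplex on the moment curve as the set \<open>V\<close> of its indices. With \<open>card V = 2 * d + 1\<close>,
  Lagrange interpolation at the nodes \<open>V\<close> makes the barycentric coordinates explicit: the \<open>t\<close>-th
  coordinate of a point is the \<open>t\<close>-th Lagrange polynomial applied to it, where a polynomial of degree
  at most \<open>2 * d\<close> acts on \<open>real ^ 'n\<close> as an affine function (\<open>affine_eval\<close>). Moving a point vertically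
  by \<open>s\<close> changes its \<open>t\<close>-th coordinate by \<open>s\<close> times the leading coefficient of that polynomial,
  that is, by \<open>s\<close> divided by \<open>\<Prod>(t - t')\<close>, taken over the other nodes \<open>t'\<close>; the sign of this
  change is \<open>+\<close> or \<open>-\<close> according to the parity of the number of nodes above \<open>t\<close>.

  Hence, if \<open>a\<^sub>0 < \<dots> < a\<^sub>2\<^sub>d\<close> are the elements of \<open>V\<close> and the barycentre of a face \<open>W\<close> of \<open>V\<close> is moved
  slightly upwards, it stays in the simplex exactly if \<open>W\<close> contains \<open>a\<^sub>1, a\<^sub>3, \<dots>, a\<^sub>2\<^sub>d\<^sub>-\<^sub>1\<close>, and if it is
  moved slightly downwards, exactly if \<open>W\<close> contains \<open>a\<^sub>0, a\<^sub>2, \<dots>, a\<^sub>2\<^sub>d\<close>. When \<open>W\<close> is equal to that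
  set, the moved point is an interior point of the simplex. In a triangulation only one cell has a
  given interior point, so a cell is determined by its odd places and also by its even places
  (\<open>shrinking_determines_cell\<close>); conversely, as long as the moved barycentre of \<open>W\<close> stays in the
  polytope, some cell contains it, and this cell has the right odd or even places
  (\<open>cell_in_direction\<close>). Two bijections follow.

  \<^item> Upwards (\<open>odd_places_bij\<close>): the cells correspond to all \<open>d\<close>-subsets of \<open>{2..<m}\<close> without
    adjacent elements. Here every cell containing the barycentre of \<open>W\<close> has \<open>W\<close> as a face,
    because the polytope is neighbourly. These subsets are counted by a binomial coefficient.
  \<^item> Downwards (\<open>even_places_bij\<close>): the cells correspond to the \<open>d\<close>-simplices in \<open>e(S)\<close>. The even
    places of a cell are in no lower facet since points below their barycentre are in the
    polytope. Conversely an element of \<open>e(S)\<close> has no adjacent entries, since a \<open>d\<close>-simplex with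
    adjacent entries extends to \<open>d\<close> disjoint pairs of neighbours, which span a lower facet
    (\<open>pair_in_lower_facet\<close>); and every set without adjacent elements consists of the even places
    of some \<open>2 * d\<close>-simplex, so that its barycentre can be moved downwards.

  Finally, two intertwining tuples together form \<open>2 * d + 2\<close> nodes, whose unique affine dependence has
  alternating signs, so the relative interiors of the two simplices meet
  (\<open>alternating_hulls_meet\<close>). If both were faces of the triangulation, one cell would contain all
  \<open>2 * d + 2\<close> vertices.
\<close>

section \<open>Alternating places in a finite set of numbers\<close>

definition above :: "nat set \<Rightarrow> nat \<Rightarrow> nat" where
  "above V t = card {s \<in> V. t < s}"

text \<open>
  Places are counted from the top, because the sign of \<open>node_prod V t\<close> below is governed by the
  number of nodes above \<open>t\<close>. For sets of odd size, the only ones whose places are read as vertices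
  of a full-dimensional simplex, the parity is the same as when counting from the bottom, starting with \<open>0\<close>.
\<close>

definition odd_places :: "nat set \<Rightarrow> nat set" where
  "odd_places V = {t \<in> V. odd (above V t)}"

definition even_places :: "nat set \<Rightarrow> nat set" where
  "even_places V = {t \<in> V. even (above V t)}"

definition separated :: "nat set \<Rightarrow> bool" where
  "separated W \<longleftrightarrow> (\<forall>w\<in>W. Suc w \<notin> W)"

lemma above_Suc:
  assumes "finite V" "Suc w \<in> V"
  shows "above V w = Suc (above V (Suc w))"
proof -
  have "{s \<in> V. w < s} = insert (Suc w) {s \<in> V. Suc w < s}"
    using assms by auto
  then show ?thesis
    using assms by (simp add: above_def)
qed

lemma separated_odd_places: "finite V \<Longrightarrow> separated (odd_places V)"
  by (auto simp: separated_def odd_places_def above_Suc)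

lemma card_odd_places: "finite V \<Longrightarrow> card (odd_places V) = card V div 2"
proof (induction V rule: finite_linorder_min_induct)
  case empty
  then show ?case by (simp add: odd_places_def)
next
  case (insert b V)
  have new: "above (insert b V) b = card V"
    unfolding above_def using insert by (intro arg_cong[where f = card]) auto
  have old: "above (insert b V) t = above V t" if "t \<in> V" for t
    unfolding above_def using insert that by (intro arg_cong[where f = card]) auto
  have b: "b \<notin> V" using insert by auto
  have "odd_places (insert b V) = (if odd (card V) then insert b (odd_places V) else odd_places V)"
    using new old b by (auto simp: odd_places_def)
  moreover have "b \<notin> odd_places V" "finite (odd_places V)"
    using b insert by (auto simp: odd_places_def)
  ultimately show ?case
    using insert b by (auto elim!: oddE evenE)
qed

lemma card_even_places:
  assumes "finite V" shows "card (even_places V) = (card V + 1) div 2"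
proof -
  have "V = odd_places V \<union> even_places V" "odd_places V \<inter> even_places V = {}"
    by (auto simp: odd_places_def even_places_def)
  then have "card V = card (odd_places V) + card (even_places V)"
    using assms by (metis card_Un_disjoint finite_Un)
  then show ?thesis using card_odd_places[OF assms] by presburger
qed

lemma odd_places_inner:
  assumes V: "V \<subseteq> {1..m}" "odd (card V)"
  shows "odd_places V \<subseteq> {2..<m}"
proof
  fix w assume w: "w \<in> odd_places V"
  have fin: "finite V" using V finite_subset by blast
  have wV: "w \<in> V" "odd (above V w)" using w by (auto simp: odd_places_def)
  have "w \<noteq> m"
  proof
    assume "w = m"
    then have "{s \<in> V. w < s} = {}" using V by auto
    then have "above V w = 0" by (simp only: above_def card.empty)
    then show False using wV by simp
  qed
  moreover have "w \<noteq> 1"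
  proof
    assume "w = 1"
    then have "{s \<in> V. w < s} = V - {w}" using V by force
    then have "above V w = card V - 1" using wV fin by (simp only: above_def card_Diff_singleton)
    then show False using wV V by simp
  qed
  moreover have "w \<in> {1..m}" using wV V by blast
  ultimately show "w \<in> {2..<m}" by auto
qed

text \<open>
  Inserting the successor of every element of \<open>W\<close>, and the number \<open>1\<close>, puts an even number of
  elements above every new element and an odd number above every old one.
\<close>

lemma odd_places_realised:
  assumes W: "W \<subseteq> {2..<m}" "separated W" and m: "1 \<le> m"
  obtains V where "V \<subseteq> {1..m}" "card V = 2 * card W + 1" "odd_places V = W"
proof -
  define V where "V = insert 1 (W \<union> Suc ` W)"
  have fin: "finite W" using W finite_subset by blast
  have disj: "W \<inter> Suc ` W = {}" "1 \<notin> W \<union> Suc ` W"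
    using W by (auto simp: separated_def)
  have "card (W \<union> Suc ` W) = 2 * card W"
    using fin disj by (simp add: card_Un_disjoint card_image)
  then have card: "card V = 2 * card W + 1"
    using fin disj by (simp add: V_def)
  have split: "above V t = above W t + card {w \<in> W. t \<le> w}" if "1 \<le> t" for t
  proof -
    have "{s \<in> V. t < s} = {s \<in> W. t < s} \<union> Suc ` {w \<in> W. t \<le> w}"
      using that by (auto simp: V_def)
    moreover have "{s \<in> W. t < s} \<inter> Suc ` {w \<in> W. t \<le> w} = {}"
      using disj by auto
    ultimately show ?thesis
      using fin by (simp add: above_def card_Un_disjoint card_image)
  qed
  have "odd (above V w)" if "w \<in> W" for w
  proof -
    have "{v \<in> W. w \<le> v} = insert w {v \<in> W. w < v}" using that by auto
    then have "card {v \<in> W. w \<le> v} = Suc (above W w)"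
      using fin by (simp add: above_def)
    moreover have "1 \<le> w" using W that by auto
    ultimately show ?thesis by (simp add: split)
  qed
  moreover have "even (above V t)" if "t \<in> V" "t \<notin> W" for t
  proof -
    have "{v \<in> W. t \<le> v} = {v \<in> W. t < v}" using that by (auto simp: order_le_less)
    then have "card {v \<in> W. t \<le> v} = above W t" by (simp only: above_def)
    moreover have "1 \<le> t" using that by (auto simp: V_def)
    ultimately show ?thesis by (simp add: split)
  qed
  ultimately have "odd_places V = W" by (auto simp: odd_places_def V_def)
  moreover have "V \<subseteq> {1..m}" using W m by (auto simp: V_def)
  ultimately show thesis using card that by blast
qed

text \<open>
  Here the successor of every element but the largest is inserted, so that the largest element of \<open>W\<close>
  stays the largest of all and is at place \<open>0\<close>.
\<close>

lemma even_places_realised: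
  assumes W: "W \<subseteq> {1..m}" "separated W" "W \<noteq> {}"
  obtains V where "V \<subseteq> {1..m}" "card V + 1 = 2 * card W" "even_places V = W"
proof -
  have fin: "finite W" using W finite_subset by blast
  define M where "M = Max W"
  have M: "M \<in> W" "\<And>w. w \<in> W \<Longrightarrow> w \<le> M" using fin W by (auto simp: M_def)
  define U where "U = W - {M}"
  define V where "V = W \<union> Suc ` U"
  have disj: "W \<inter> Suc ` U = {}"
    using W by (auto simp: separated_def U_def)
  have cU: "card U + 1 = card W"
    unfolding U_def using M(1) fin by (metis Suc_eq_plus1 card_Suc_Diff1)
  have "card V = card W + card U"
    using fin disj by (simp add: V_def card_Un_disjoint card_image U_def)
  then have card: "card V + 1 = 2 * card W" using cU by simp
  have split: "above V t = above W t + card {w \<in> U. t \<le> w}" for t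
  proof -
    have "{s \<in> V. t < s} = {s \<in> W. t < s} \<union> Suc ` {w \<in> U. t \<le> w}"
      by (auto simp: V_def)
    moreover have "{s \<in> W. t < s} \<inter> Suc ` {w \<in> U. t \<le> w} = {}"
      using disj by auto
    ultimately show ?thesis
      using fin by (simp add: above_def card_Un_disjoint card_image U_def)
  qed
  have "even (above V w)" if "w \<in> W" for w
  proof (cases "w = M")
    case True
    have "{s \<in> W. M < s} = {}" "{u \<in> U. M \<le> u} = {}"
      using M(2) by (auto simp: U_def leD intro: le_antisym)
    then have "above W M = 0" "card {u \<in> U. M \<le> u} = 0"
      by (simp_all only: above_def card.empty)
    then show ?thesis by (simp add: split True)
  next
    case False
    have "{v \<in> W. w < v} = insert M {v \<in> U. w < v}"
      using that M False by (auto simp: U_def order_le_less)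
    moreover have "{v \<in> U. w \<le> v} = insert w {v \<in> U. w < v}"
      using that False by (auto simp: U_def)
    ultimately have "above W w = card {v \<in> U. w \<le> v}"
      using fin by (simp add: above_def U_def)
    then show ?thesis by (simp add: split)
  qed
  moreover have "odd (above V t)" if "t \<in> V" "t \<notin> W" for t
  proof -
    obtain u where u: "t = Suc u" "u \<in> U" using \<open>t \<in> V\<close> \<open>t \<notin> W\<close> by (auto simp: V_def)
    then have "u < M" using M(2)[of u] by (auto simp: U_def)
    then have "t < M" using u M(1) \<open>t \<notin> W\<close> by (metis Suc_lessI)
    have "{v \<in> W. t < v} = insert M {v \<in> U. t < v}"
      using M \<open>t < M\<close> by (auto simp: U_def)
    moreover have "{v \<in> U. t \<le> v} = {v \<in> U. t < v}"
      using \<open>t \<notin> W\<close> by (auto simp: U_def order_le_less)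
    ultimately have "above W t = Suc (card {v \<in> U. t \<le> v})"
      using fin by (simp add: above_def U_def)
    then show ?thesis by (simp add: split)
  qed
  ultimately have "even_places V = W" by (auto simp: even_places_def V_def)
  moreover have "V \<subseteq> {1..m}"
  proof -
    have "Suc u \<in> {1..m}" if "u \<in> U" for u
    proof -
      have "u < M" using M(2)[of u] that by (auto simp: U_def)
      then show ?thesis using M(1) W(1) by fastforce
    qed
    then show ?thesis using W by (auto simp: V_def)
  qed
  ultimately show thesis using card that by blast
qed

section \<open>Counting and covering by pairs of neighbours\<close>

text \<open>
  Splitting by whether the largest number \<open>n + 3\<close> occurs gives Pascal's recurrence: if it does, then
  \<open>n + 2\<close> does not, and the remaining elements form such a set for \<open>n\<close>.
\<close>

lemma card_separated_subsets:
  "card {W. W \<subseteq> {2..<n + 2} \<and> card W = k \<and> separated W} = (n + 1 - k) choose k"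
proof (induction n arbitrary: k rule: induct_nat_012)
  case 0
  show ?case
  proof (cases k)
    case 0
    have "{W. W \<subseteq> {2..<0 + 2} \<and> card W = k \<and> separated W} = {{}}"
      using 0 by (auto simp: separated_def)
    then show ?thesis using 0 by simp
  next
    case (Suc j)
    have "{W. W \<subseteq> {2..<0 + 2} \<and> card W = k \<and> separated W} = {}"
      using Suc by auto
    then show ?thesis using Suc by simp
  qed
next
  case 1
  have sub: "W \<subseteq> {2..<Suc 0 + 2} \<longleftrightarrow> W = {} \<or> W = {2}" for W :: "nat set"
  proof -
    have "{2..<Suc 0 + 2} = {2::nat}" by auto
    then show ?thesis by (simp add: subset_singleton_iff)
  qed
  consider "k = 0" | "k = 1" | "k \<ge> 2" by linarith
  then show ?case
  proof cases
    case 1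
    have "{W. W \<subseteq> {2..<Suc 0 + 2} \<and> card W = k \<and> separated W} = {{}}"
      unfolding sub using 1 by (auto simp: separated_def)
    then show ?thesis using 1 by simp
  next
    case 2
    have "{W. W \<subseteq> {2..<Suc 0 + 2} \<and> card W = k \<and> separated W} = {{2}}"
      unfolding sub using 2 by (auto simp: separated_def)
    then show ?thesis using 2 by simp
  next
    case 3
    have "{W. W \<subseteq> {2..<Suc 0 + 2} \<and> card W = k \<and> separated W} = {}"
      unfolding sub using 3 by auto
    then show ?thesis using 3 by (simp add: binomial_eq_0)
  qed
next
  case (ge2 n)
  let ?A = "\<lambda>n k. {W. W \<subseteq> {2..<n + 2} \<and> card W = k \<and> separated W}"
  have fin: "finite (?A n k)" for n k
    by (rule finite_subset[of _ "Pow {2..<n+2}"]) auto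
  show ?case
  proof (cases k)
    case 0
    have "?A (Suc (Suc n)) 0 = {{}}"
      by (auto simp: separated_def dest: finite_subset[OF _ finite_atLeastLessThan])
    then show ?thesis unfolding 0 by simp
  next
    case (Suc j)
    have out: "n + 3 \<notin> W" if "W \<in> ?A n j" for W
      using that by auto
    have "?A (Suc (Suc n)) (Suc j) = ?A (Suc n) (Suc j) \<union> insert (n + 3) ` ?A n j"
    proof (intro equalityI subsetI)
      fix W assume W: "W \<in> ?A (Suc (Suc n)) (Suc j)"
      have finW: "finite W" using W finite_subset by blast
      show "W \<in> ?A (Suc n) (Suc j) \<union> insert (n + 3) ` ?A n j"
      proof (cases "n + 3 \<in> W")
        case False
        have "w < Suc n + 2" if "w \<in> W" for w
        proof -
          have "w < n + 4" "w \<noteq> n + 3" using that W False by auto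
          then show ?thesis by simp
        qed
        then have "W \<in> ?A (Suc n) (Suc j)" using W by auto
        then show ?thesis by blast
      next
        case True
        define U where "U = W - {n + 3}"
        have "n + 2 \<notin> W"
        proof
          assume "n + 2 \<in> W"
          then have "Suc (n + 2) \<notin> W" using W by (simp add: separated_def)
          then show False using True by (simp add: numeral_3_eq_3)
        qed
        have "w \<in> {2..<n + 2}" if "w \<in> U" for w
        proof -
          have "2 \<le> w" "w < n + 4" "w \<noteq> n + 3" "w \<noteq> n + 2"
            using that W \<open>n + 2 \<notin> W\<close> by (auto simp: U_def)
          then show ?thesis by simp
        qed
        moreover have "card U = j" using W True finW by (simp add: U_def)
        moreover have "separated U" using W by (simp add: separated_def U_def)
        ultimately have "U \<in> ?A n j" using W by auto
        moreover have "W = insert (n + 3) U" using True by (auto simp: U_def)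
        ultimately show ?thesis by blast
      qed
    next
      fix W assume "W \<in> ?A (Suc n) (Suc j) \<union> insert (n + 3) ` ?A n j"
      then show "W \<in> ?A (Suc (Suc n)) (Suc j)"
      proof
        assume "W \<in> insert (n + 3) ` ?A n j"
        then obtain U where U: "U \<in> ?A n j" "W = insert (n + 3) U" by blast
        have "finite U" using U finite_subset by blast
        then have "card W = Suc j" using U out[OF U(1)] by simp
        moreover have "separated W"
          using U by (auto simp: separated_def)
        ultimately show ?thesis using U by auto
      qed auto
    qed
    moreover have "?A (Suc n) (Suc j) \<inter> insert (n + 3) ` ?A n j = {}"
      by auto
    moreover have "inj_on (insert (n + 3)) (?A n j)"
      using out by (intro inj_onI) (metis insert_ident)
    ultimately have "card (?A (Suc (Suc n)) (Suc j)) = card (?A (Suc n) (Suc j)) + card (?A n j)"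
      using fin by (simp add: card_Un_disjoint card_image)
    also have "\<dots> = (Suc n + 1 - Suc j choose Suc j) + (n + 1 - j choose j)"
      using ge2 by simp
    also have "\<dots> = (Suc (Suc n) + 1 - Suc j choose Suc j)"
    proof (cases "j \<le> n + 1")
      case True
      then have "Suc (Suc n) + 1 - Suc j = Suc (n + 1 - j)" by simp
      then show ?thesis by simp
    qed (simp add: binomial_eq_0)
    finally show ?thesis using Suc by simp
  qed
qed

text \<open>
  Pairs \<open>{r, Suc r}\<close> are chosen from the top end. Each pair placed on an element \<open>m\<close> of \<open>X\<close> uses up at
  least one element; it uses up only one if \<open>m - 1\<close> is not in \<open>X\<close>, and then a pair of neighbours of
  \<open>X\<close> survives below. The spare pair is what allows one more element than there are pairs. If
  \<open>m = 2 * k\<close> the pairs cover everything.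
\<close>

lemma cover_by_pairs:
  assumes "X \<subseteq> {1..m}" "2 * k \<le> m"
    "card X \<le> k \<or> card X \<le> Suc k \<and> (\<exists>r\<in>X. Suc r \<in> X)"
  obtains R where "card R = k" "R \<inter> Suc ` R = {}" "X \<subseteq> R \<union> Suc ` R" "R \<union> Suc ` R \<subseteq> {1..m}"
proof -
  have "\<exists>R. card R = k \<and> R \<inter> Suc ` R = {} \<and> X \<subseteq> R \<union> Suc ` R \<and> R \<union> Suc ` R \<subseteq> {1..m}"
    using assms
  proof (induction m arbitrary: k X rule: less_induct)
    case (less m)
    have finX: "finite X" using less.prems finite_subset by blast
    consider "k = 0" | "m = 2 * k" | "k > 0" "2 * k < m" "m \<notin> X" | "k > 0" "2 * k < m" "m \<in> X"
      using less.prems by linarith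
    then show ?case
    proof cases
      case 1
      have "X = {}"
      proof (rule ccontr)
        assume "X \<noteq> {}"
        then obtain r where "{r, Suc r} \<subseteq> X" "card X \<le> 1"
          using less.prems 1 finX by auto
        then show False using card_mono[OF finX, of "{r, Suc r}"] by simp
      qed
      then show ?thesis using 1 by (intro exI[of _ "{}"]) auto
    next
      case 2
      let ?R = "(\<lambda>i. 2 * i + 1) ` {..<k}"
      have cover: "x \<in> ?R \<union> Suc ` ?R" if "x \<in> {1..m}" for x
      proof (cases "even x")
        case True
        then obtain i where "x = 2 * i" by (elim evenE)
        then have "x = Suc (2 * (i - 1) + 1)" "i - 1 < k" using that 2 by auto
        then show ?thesis by blast
      next
        case False
        then obtain i where "x = 2 * i + 1" by (elim oddE)
        then have "i < k" using that 2 by auto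
        then show ?thesis using \<open>x = 2 * i + 1\<close> by blast
      qed
      have "card ?R = k" by (subst card_image) (auto simp: inj_on_def)
      moreover have "?R \<inter> Suc ` ?R = {}" by (auto, presburger)
      moreover have "?R \<union> Suc ` ?R \<subseteq> {1..m}" using 2 by auto
      moreover have "X \<subseteq> ?R \<union> Suc ` ?R" using cover less.prems(1) by blast
      ultimately show ?thesis by (intro exI[of _ ?R] conjI)
    next
      case 3
      have sub: "X \<subseteq> {1..m - 1}"
      proof
        fix x assume "x \<in> X"
        then have "x \<in> {1..m}" "x \<noteq> m" using 3 less.prems(1) by auto
        then show "x \<in> {1..m - 1}" by auto
      qed
      have "m - 1 < m" "2 * k \<le> m - 1" using 3 by auto
      from less.IH[OF this(1) sub this(2) less.prems(3)]
      obtain R where "card R = k" "R \<inter> Suc ` R = {}" "X \<subseteq> R \<union> Suc ` R" "R \<union> Suc ` R \<subseteq> {1..m-1}"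
        by blast
      moreover have "{1..m - 1} \<subseteq> {1..m}" by auto
      ultimately show ?thesis by blast
    next
      case 4
      then obtain n where m: "m = Suc (Suc n)"
        by (metis less_imp_Suc_add mult_2 add_Suc_right add_Suc)
      \<comment> \<open>The pair \<open>{Suc n, m}\<close> is used; \<open>Y\<close> is what the remaining \<open>k - 1\<close> pairs have to cover.\<close>
      define Y where "Y = X - {Suc n, m}"
      have sub: "Y \<subseteq> {1..n}"
      proof
        fix x assume "x \<in> Y"
        then have "x \<in> {1..m}" "x \<noteq> m" "x \<noteq> Suc n" using less.prems(1) by (auto simp: Y_def)
        then show "x \<in> {1..n}" using m by auto
      qed
      have "card Y \<le> k - 1 \<or> card Y \<le> Suc (k - 1) \<and> (\<exists>r\<in>Y. Suc r \<in> Y)"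
      proof (cases "Suc n \<in> X")
        case True
        have "card Y = card X - card {Suc n, m}"
          unfolding Y_def using True 4 finX by (intro card_Diff_subset) auto
        then have "card Y = card X - 2" using m by simp
        then show ?thesis using less.prems(3) by linarith
      next
        case False
        then have "Y = X - {m}" by (auto simp: Y_def)
        then have "card Y = card X - 1" using 4 finX by simp
        moreover have "\<exists>r\<in>Y. Suc r \<in> Y" if "r \<in> X" "Suc r \<in> X" for r
        proof -
          have "r \<noteq> Suc n" "Suc r \<noteq> Suc n" using False that by metis+
          moreover have "r \<noteq> m" using that less.prems(1) by auto
          ultimately have "r \<in> Y" "Suc r \<in> Y" using that by (auto simp: Y_def m)
          then show ?thesis by blast
        qed
        ultimately show ?thesis using less.prems(3) 4 by auto
      qed
      moreover have "n < m" "2 * (k - 1) \<le> n" using 4 m by auto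
      ultimately obtain R where R: "card R = k - 1" "R \<inter> Suc ` R = {}" "Y \<subseteq> R \<union> Suc ` R"
          "R \<union> Suc ` R \<subseteq> {1..n}"
        using less.IH[OF _ sub] by blast
      have finR: "finite R" using R(4) finite_subset by blast
      have out: "Suc n \<notin> R \<union> Suc ` R" "m \<notin> R \<union> Suc ` R"
        using R(4) m by fastforce+
      have "card (insert (Suc n) R) = k" using R finR out 4 by simp
      moreover have "insert (Suc n) R \<inter> Suc ` insert (Suc n) R = {}"
        using R(2) out m by auto
      moreover have "X \<subseteq> insert (Suc n) R \<union> Suc ` insert (Suc n) R"
        using R(3) m unfolding Y_def by auto
      moreover have "insert (Suc n) R \<union> Suc ` insert (Suc n) R \<subseteq> {1..m}"
        using R(4) unfolding m by fastforce
      ultimately show ?thesis by blast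
    qed
  qed
  then show thesis using that by blast
qed

section \<open>Lagrange interpolation at natural nodes\<close>

definition node_prod :: "nat set \<Rightarrow> nat \<Rightarrow> real" where
  "node_prod V t = (\<Prod>s\<in>V - {t}. real t - real s)"

definition lagrange_basis :: "nat set \<Rightarrow> nat \<Rightarrow> real poly" where
  "lagrange_basis V t = smult (inverse (node_prod V t)) (\<Prod>s\<in>V - {t}. [:- real s, 1:])"

lemma node_prod_nonzero: "finite V \<Longrightarrow> node_prod V t \<noteq> 0"
  by (simp add: node_prod_def)

text \<open>
  The factors that belong to nodes above \<open>t\<close> are the negative ones.
\<close>

lemma node_prod_sign:
  assumes "finite V"
  shows "0 < (-1) ^ above V t * node_prod V t"
proof -
  let ?lo = "{s \<in> V. s < t}" and ?hi = "{s \<in> V. t < s}"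
  have "V - {t} = ?lo \<union> ?hi" by auto
  then have "node_prod V t = (\<Prod>s\<in>?lo. real t - real s) * (\<Prod>s\<in>?hi. real t - real s)"
    using assms unfolding node_prod_def by (simp only:) (rule prod.union_disjoint; force)
  also have "(\<Prod>s\<in>?hi. real t - real s) = (\<Prod>s\<in>?hi. (-1) * (real s - real t))"
    by (intro prod.cong) auto
  also have "\<dots> = (-1) ^ above V t * (\<Prod>s\<in>?hi. real s - real t)"
    unfolding above_def by (subst prod.distrib) simp
  finally have "(-1) ^ above V t * node_prod V t =
      (\<Prod>s\<in>?lo. real t - real s) * (\<Prod>s\<in>?hi. real s - real t)"
    by simp
  moreover have "0 < (\<Prod>s\<in>?lo. real t - real s)" "0 < (\<Prod>s\<in>?hi. real s - real t)"
    by (auto intro!: prod_pos)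
  ultimately show ?thesis by simp
qed

lemma node_prod_pos_iff:
  assumes "finite V" shows "0 < node_prod V t \<longleftrightarrow> even (above V t)"
  using node_prod_sign[OF assms, of t] node_prod_nonzero[OF assms, of t]
  by (cases "even (above V t)") auto

lemma degree_prod_linear: "degree (\<Prod>s\<in>A. [:- real s, 1:]) = card A"
  by (subst degree_prod_sum_eq) auto

lemma coeff_prod_linear: "coeff (\<Prod>s\<in>A. [:- real s, 1:]) (card A) = 1"
  using lead_coeff_prod[of "\<lambda>s. [:- real s, 1:]" A] by (simp add: degree_prod_linear)

lemma degree_lagrange_basis:
  assumes "finite V" "t \<in> V" shows "degree (lagrange_basis V t) = card V - 1"
  using assms by (simp add: lagrange_basis_def node_prod_nonzero degree_prod_linear)

lemma coeff_lagrange_basis: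
  assumes "finite V" "t \<in> V"
  shows "coeff (lagrange_basis V t) (card V - 1) = inverse (node_prod V t)"
  using assms coeff_prod_linear[of "V - {t}"] by (simp add: lagrange_basis_def)

lemma poly_lagrange_basis:
  assumes "finite V" "t \<in> V" "s \<in> V"
  shows "poly (lagrange_basis V t) (real s) = (if s = t then 1 else 0)"
proof (cases "s = t")
  case True
  then show ?thesis using node_prod_nonzero[OF assms(1), of t]
    by (simp add: lagrange_basis_def poly_prod node_prod_def)
next
  case False
  then have "(\<Prod>r\<in>V - {t}. real s - real r) = 0" using assms by auto
  then show ?thesis using False by (simp add: lagrange_basis_def poly_prod)
qed

lemma lagrange_interpolation:
  assumes "finite V" "degree f < card V"
  shows "f = (\<Sum>t\<in>V. smult (poly f (real t)) (lagrange_basis V t))" (is "_ = ?g")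
proof (rule poly_eqI_degree[where A = "real ` V"])
  fix x assume "x \<in> real ` V"
  then obtain s where s: "s \<in> V" "x = real s" by blast
  have "poly ?g x = (\<Sum>t\<in>V. if t = s then poly f (real t) else 0)"
    unfolding s(2) poly_sum
    by (intro sum.cong refl) (simp add: poly_lagrange_basis[OF assms(1) _ s(1)])
  then show "poly f x = poly ?g x" using s assms by simp
next
  have card: "card (real ` V) = card V" by (simp add: card_image)
  show "degree f < card (real ` V)" using assms card by simp
  have "degree ?g \<le> card V - 1"
    using assms(1)
    by (intro degree_sum_le) (auto intro: order_trans[OF degree_smult_le] simp: degree_lagrange_basis)
  then show "degree ?g < card (real ` V)" using assms card by linarith
qed

text \<open>
  This is the classical formula for divided differences: comparing leading coefficients in the
  interpolation formula.
\<close>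

lemma top_coeff_interpolation:
  assumes "finite V" "degree f < card V"
  shows "coeff f (card V - 1) = (\<Sum>t\<in>V. poly f (real t) / node_prod V t)"
proof -
  have "coeff f (card V - 1)
      = coeff (\<Sum>t\<in>V. smult (poly f (real t)) (lagrange_basis V t)) (card V - 1)"
    using lagrange_interpolation[OF assms] by simp
  also have "\<dots> = (\<Sum>t\<in>V. poly f (real t) / node_prod V t)"
    unfolding coeff_sum
    by (intro sum.cong refl) (simp only: coeff_smult coeff_lagrange_basis[OF assms(1)] divide_inverse)
  finally show ?thesis .
qed

section \<open>Barycentric coordinates on the moment curve\<close>

text \<open>
  A polynomial \<open>f\<close> of degree at most \<open>2 * d\<close> is used as the affine function on \<open>real ^ 'n\<close> that
  restricts to \<open>f\<close> on the moment curve; it has the coefficients of \<open>f\<close> as its coefficients.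
  The vector \<open>up\<close> is the unit vector of the last coordinate.
\<close>

locale moment_curve =
  fixes c :: "'n::finite \<Rightarrow> nat" and d :: nat
  assumes d_pos: "1 \<le> d" and coords: "bij_betw c UNIV {1..2 * d}"
begin

abbreviation p :: "nat \<Rightarrow> real ^ 'n" where
  "p \<equiv> moment_point c"

definition affine_eval :: "real poly \<Rightarrow> real ^ 'n \<Rightarrow> real" where
  "affine_eval f x = coeff f 0 + (\<chi> i. coeff f (c i)) \<bullet> x"

definition up :: "real ^ 'n" where
  "up = (\<chi> i. if c i = 2 * d then 1 else 0)"

lemma dim: "DIM(real ^ 'n) = 2 * d"
  using bij_betw_same_card[OF coords] by simp

lemma sum_coords: "(\<Sum>i\<in>UNIV. g (c i)) = (\<Sum>k\<in>{1..2 * d}. g k)"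
  using sum.reindex_bij_betw[OF coords] .

lemma affine_eval_moment_point:
  assumes "degree f \<le> 2 * d" shows "affine_eval f (p t) = poly f (real t)"
proof -
  have "affine_eval f (p t) = coeff f 0 + (\<Sum>k\<in>{1..2 * d}. coeff f k * real t ^ k)"
    by (simp add: affine_eval_def inner_vec_def moment_point_def sum_coords[of "\<lambda>k. coeff f k * real t ^ k"])
  also have "\<dots> = (\<Sum>k\<le>2 * d. coeff f k * real t ^ k)"
    by (simp add: sum.atMost_shift sum.atLeast1_atMost_eq lessThan_Suc_atMost)
  also have "\<dots> = poly f (real t)"
    unfolding poly_altdef using assms
    by (intro sum.mono_neutral_right) (auto simp: coeff_eq_0)
  finally show ?thesis .
qed

lemma affine_eval_up: "affine_eval f (x + s *\<^sub>R up) = affine_eval f x + s * coeff f (2 * d)"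
proof -
  have "(\<chi> i. coeff f (c i)) \<bullet> up = (\<Sum>k\<in>{1..2 * d}. if k = 2 * d then coeff f k else 0)"
    by (subst sum_coords[symmetric])
      (simp add: inner_vec_def up_def if_distrib[of "\<lambda>a. _ * a"] cong: if_cong)
  also have "\<dots> = coeff f (2 * d)" using d_pos by simp
  finally show ?thesis by (simp add: affine_eval_def inner_add_right)
qed

lemma affine_eval_combination:
  assumes "sum u A = 1"
  shows "affine_eval f (\<Sum>a\<in>A. u a *\<^sub>R x a) = (\<Sum>a\<in>A. u a * affine_eval f (x a))"
proof -
  have "coeff f 0 = (\<Sum>a\<in>A. u a * coeff f 0)" using assms by (simp flip: sum_distrib_right)
  then show ?thesis
    by (simp add: affine_eval_def inner_sum_right distrib_left sum.distrib)
qed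

lemma affine_eval_moment_points:
  assumes "degree f \<le> 2 * d" "sum u A = 1"
  shows "affine_eval f (\<Sum>t\<in>A. u t *\<^sub>R p t) = (\<Sum>t\<in>A. u t * poly f (real t))"
  using assms by (simp add: affine_eval_combination affine_eval_moment_point)

lemma affine_eval_sum_smult: "affine_eval (\<Sum>a\<in>A. smult (u a) (f a)) x = (\<Sum>a\<in>A. u a * affine_eval (f a) x)"
proof -
  have "(\<chi> i. coeff (\<Sum>a\<in>A. smult (u a) (f a)) (c i)) = (\<Sum>a\<in>A. u a *\<^sub>R (\<chi> i. coeff (f a) (c i)))"
    by (simp add: vec_eq_iff coeff_sum)
  then show ?thesis
    by (simp add: affine_eval_def coeff_sum inner_sum_left distrib_left sum.distrib)
qed

lemma continuous_affine_eval: "continuous_on UNIV (affine_eval f)"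
  unfolding affine_eval_def by (intro continuous_intros)

lemma affine_eval_const: "affine_eval 1 x = 1"
proof -
  have "coeff (1 :: real poly) (c i) = 0" for i
    using bij_betwE[OF coords, rule_format, of i] by (auto simp: coeff_eq_0)
  moreover have "coeff (1 :: real poly) 0 = 1" by simp
  ultimately show ?thesis by (simp add: affine_eval_def inner_vec_def del: coeff_1)
qed

lemma affine_eval_coordinate: "affine_eval (monom 1 (c i)) x = x $ i"
proof -
  have "coeff (monom 1 (c i)) (c j) * x $ j = (if j = i then x $ i else 0)" for j
  proof (cases "j = i")
    case False
    then have "c i \<noteq> c j" using bij_betw_imp_inj_on[OF coords] by (metis UNIV_I inj_onD)
    then show ?thesis using False by simp
  qed simp
  moreover have "c i \<noteq> 0" using bij_betwE[OF coords, rule_format, of i] by auto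
  ultimately show ?thesis
    by (simp add: affine_eval_def inner_vec_def)
qed

lemma coord_le: "c i \<le> 2 * d"
  using bij_betwE[OF coords, rule_format, of i] by auto

lemma inj_p: "inj p"
proof
  fix s t assume "p s = p t"
  then have "affine_eval [:0, 1:] (p s) = affine_eval [:0, 1:] (p t)" by simp
  then show "s = t" using d_pos by (simp add: affine_eval_moment_point)
qed

lemma inj_on_p: "inj_on p A"
  using inj_p inj_on_subset by blast

lemma card_p: "card (p ` A) = card A"
  by (simp add: card_image inj_on_p)

lemma hull_combination:
  assumes "finite A" "x \<in> convex hull (p ` A)"
  obtains u where "\<And>t. t \<in> A \<Longrightarrow> 0 \<le> u t" "sum u A = 1" "x = (\<Sum>t\<in>A. u t *\<^sub>R p t)"
proof -
  obtain v where v: "\<forall>y\<in>p ` A. 0 \<le> v y" "sum v (p ` A) = 1" "(\<Sum>y\<in>p ` A. v y *\<^sub>R y) = x"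
    using assms by (auto simp: convex_hull_finite)
  show thesis
  proof (rule that[of "\<lambda>t. v (p t)"])
    show "(\<Sum>t\<in>A. v (p t)) = 1" using v(2) by (simp add: sum.reindex inj_on_p)
    show "x = (\<Sum>t\<in>A. v (p t) *\<^sub>R p t)" using v(3) by (simp add: sum.reindex inj_on_p)
  qed (use v(1) in auto)
qed

lemma affine_eval_nonneg:
  assumes f: "degree f \<le> 2 * d" "\<And>t. t \<in> A \<Longrightarrow> 0 \<le> poly f (real t)"
    and x: "finite A" "x \<in> convex hull (p ` A)"
  shows "0 \<le> affine_eval f x"
proof -
  obtain u where u: "\<And>t. t \<in> A \<Longrightarrow> 0 \<le> u t" "sum u A = 1" "x = (\<Sum>t\<in>A. u t *\<^sub>R p t)"
    using hull_combination[OF x] by metis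
  then show ?thesis using f by (simp add: affine_eval_moment_points sum_nonneg)
qed

lemma combination_in_hull:
  assumes "finite A" "\<And>t. t \<in> A \<Longrightarrow> 0 \<le> u t" "sum u A = 1"
  shows "(\<Sum>t\<in>A. u t *\<^sub>R p t) \<in> convex hull (p ` A)"
  using assms by (intro convex_sum) (auto intro: hull_inc)

lemma combination_in_rel_interior:
  assumes "finite A" "\<And>t. t \<in> A \<Longrightarrow> 0 < u t" "sum u A = 1"
  shows "(\<Sum>t\<in>A. u t *\<^sub>R p t) \<in> rel_interior (convex hull (p ` A))"
proof -
  define v where "v y = u (inv p y)" for y
  have v: "v (p t) = u t" for t by (simp add: v_def inj_p)
  have "(\<forall>y\<in>p ` A. 0 < v y) \<and> sum v (p ` A) = 1 \<and>
      (\<Sum>y\<in>p ` A. v y *\<^sub>R y) = (\<Sum>t\<in>A. u t *\<^sub>R p t)"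
    using assms by (auto simp: sum.reindex inj_on_p v)
  then show ?thesis
    using explicit_subset_rel_interior_convex_hull_minimal[of "p ` A"] assms(1) by blast
qed

definition bary :: "nat set \<Rightarrow> nat \<Rightarrow> real ^ 'n \<Rightarrow> real" where
  "bary V t x = affine_eval (lagrange_basis V t) x"

lemma bary_combination:
  assumes V: "finite V" "card V = 2 * d + 1" "t \<in> V" and A: "A \<subseteq> V" "sum u A = 1"
  shows "bary V t (\<Sum>s\<in>A. u s *\<^sub>R p s) = (if t \<in> A then u t else 0)"
proof -
  have "bary V t (\<Sum>s\<in>A. u s *\<^sub>R p s) = (\<Sum>s\<in>A. u s * poly (lagrange_basis V t) (real s))"
    unfolding bary_def using V A by (intro affine_eval_moment_points) (simp_all add: degree_lagrange_basis)
  also have "\<dots> = (\<Sum>s\<in>A. if s = t then u s else 0)"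
    using V A by (intro sum.cong refl) (auto simp: poly_lagrange_basis subset_iff)
  also have "\<dots> = (if t \<in> A then u t else 0)"
    using finite_subset[OF A(1) V(1)] by simp
  finally show ?thesis .
qed

lemma bary_up:
  assumes "finite V" "card V = 2 * d + 1" "t \<in> V"
  shows "bary V t (x + s *\<^sub>R up) = bary V t x + s / node_prod V t"
  using coeff_lagrange_basis[of V t] assms by (simp add: bary_def affine_eval_up divide_inverse)

text \<open>
  The barycentric coordinates integrate every polynomial of degree at most \<open>2 * d\<close> exactly. The
  constant polynomial and the monomials then give the representation of a point by its coordinates.
\<close>

lemma bary_sum:
  assumes V: "finite V" "card V = 2 * d + 1" and f: "degree f \<le> 2 * d"
  shows "(\<Sum>t\<in>V. bary V t x * poly f (real t)) = affine_eval f x"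
proof -
  have "affine_eval f x = affine_eval (\<Sum>t\<in>V. smult (poly f (real t)) (lagrange_basis V t)) x"
    using lagrange_interpolation[of V f] assms by simp
  then show ?thesis by (simp add: affine_eval_sum_smult bary_def mult.commute)
qed

lemma bary_representation:
  assumes V: "finite V" "card V = 2 * d + 1"
  shows "(\<Sum>t\<in>V. bary V t x) = 1" "x = (\<Sum>t\<in>V. bary V t x *\<^sub>R p t)"
proof -
  show "(\<Sum>t\<in>V. bary V t x) = 1"
    using bary_sum[OF V, of 1 x] by (simp add: affine_eval_const)
  show "x = (\<Sum>t\<in>V. bary V t x *\<^sub>R p t)"
  proof (rule vec_eq_iff[THEN iffD2], rule allI)
    fix i
    have "degree (monom (1::real) (c i)) \<le> 2 * d" by (simp add: degree_monom_eq coord_le)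
    from bary_sum[OF V this, of x]
    show "x $ i = (\<Sum>t\<in>V. bary V t x *\<^sub>R p t) $ i"
      by (simp add: affine_eval_coordinate poly_monom moment_point_def)
  qed
qed

lemma simplex_iff_bary:
  assumes V: "finite V" "card V = 2 * d + 1"
  shows "x \<in> convex hull (p ` V) \<longleftrightarrow> (\<forall>t\<in>V. 0 \<le> bary V t x)"
proof
  assume "x \<in> convex hull (p ` V)"
  then obtain u where "\<And>t. t \<in> V \<Longrightarrow> 0 \<le> u t" "sum u V = 1" "x = (\<Sum>t\<in>V. u t *\<^sub>R p t)"
    using hull_combination[OF V(1)] by metis
  then show "\<forall>t\<in>V. 0 \<le> bary V t x" using V by (simp add: bary_combination)
next
  assume "\<forall>t\<in>V. 0 \<le> bary V t x"
  then have "(\<Sum>t\<in>V. bary V t x *\<^sub>R p t) \<in> convex hull (p ` V)"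
    using V bary_representation[OF V] by (intro combination_in_hull) auto
  then show "x \<in> convex hull (p ` V)" using bary_representation(2)[OF V, of x] by simp
qed

lemma interior_simplex_bary:
  assumes V: "finite V" "card V = 2 * d + 1" and x: "\<And>t. t \<in> V \<Longrightarrow> 0 < bary V t x"
  shows "x \<in> interior (convex hull (p ` V))"
proof (rule interiorI)
  have "{y. \<forall>t\<in>V. 0 < bary V t y} = (\<Inter>t\<in>V. {y. 0 < affine_eval (lagrange_basis V t) y})"
    by (auto simp: bary_def)
  moreover have "open {y. 0 < affine_eval f y}" for f
    by (intro open_Collect_less continuous_affine_eval continuous_on_const)
  ultimately show "open {y. \<forall>t\<in>V. 0 < bary V t y}" using V by auto
  show "{y. \<forall>t\<in>V. 0 < bary V t y} \<subseteq> convex hull (p ` V)"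
    by (auto simp: simplex_iff_bary[OF V] less_imp_le)
qed (use x in auto)

section \<open>Moving a barycentre vertically\<close>

definition centre :: "nat set \<Rightarrow> real ^ 'n" where
  "centre W = (\<Sum>w\<in>W. (1 / real (card W)) *\<^sub>R p w)"

lemma centre_in_rel_interior:
  assumes "finite W" "W \<noteq> {}"
  shows "centre W \<in> rel_interior (convex hull (p ` W))"
  unfolding centre_def using assms by (intro combination_in_rel_interior) (auto simp: card_gt_0_iff)

lemma bary_centre_up:
  assumes V: "finite V" "card V = 2 * d + 1" "t \<in> V" and W: "W \<subseteq> V" "W \<noteq> {}"
  shows "bary V t (centre W + s *\<^sub>R up) = (if t \<in> W then 1 / real (card W) else 0) + s / node_prod V t"
proof -
  have "finite W" using V W finite_subset by blast
  then show ?thesis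
    unfolding centre_def using V W by (simp add: bary_up bary_combination)
qed

text \<open>
  The vertices of \<open>V\<close> whose barycentric coordinate decreases when a point moves in the direction
  \<open>\<sigma> *\<^sub>R up\<close>. For \<open>\<sigma> = 1\<close> these are the odd places, for \<open>\<sigma> = -1\<close> the even places.
\<close>

definition shrinking :: "real \<Rightarrow> nat set \<Rightarrow> nat set" where
  "shrinking \<sigma> V = {t \<in> V. \<sigma> * node_prod V t < 0}"

lemma shrinking_up:
  assumes "finite V" shows "shrinking 1 V = odd_places V"
proof -
  have "node_prod V t < 0 \<longleftrightarrow> odd (above V t)" for t
    using node_prod_pos_iff[OF assms, of t] node_prod_nonzero[OF assms, of t] by linarith
  then show ?thesis by (simp add: shrinking_def odd_places_def)
qed

lemma shrinking_down: "finite V \<Longrightarrow> shrinking (-1) V = even_places V"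
  by (simp add: shrinking_def even_places_def node_prod_pos_iff)

text \<open>
  A coordinate that is zero at the start and decreases would become negative, so every shrinking
  vertex must have a positive coordinate at the barycentre of \<open>W\<close>.
\<close>

lemma shrinking_subset:
  assumes V: "finite V" "card V = 2 * d + 1" and W: "W \<subseteq> V" "W \<noteq> {}"
    and s: "\<sigma> \<noteq> 0" "0 < \<epsilon>" "centre W + (\<epsilon> * \<sigma>) *\<^sub>R up \<in> convex hull (p ` V)"
  shows "shrinking \<sigma> V \<subseteq> W"
proof (rule subsetI, rule ccontr)
  fix t assume t: "t \<in> shrinking \<sigma> V" "t \<notin> W"
  then have "t \<in> V" "\<sigma> * node_prod V t < 0" by (auto simp: shrinking_def)
  have "0 \<le> bary V t (centre W + (\<epsilon> * \<sigma>) *\<^sub>R up)"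
    using s \<open>t \<in> V\<close> by (simp add: simplex_iff_bary[OF V])
  then have "0 \<le> \<epsilon> * \<sigma> / node_prod V t"
    using bary_centre_up[OF V \<open>t \<in> V\<close> W] t by simp
  moreover have "\<sigma> / node_prod V t < 0"
    using \<open>\<sigma> * node_prod V t < 0\<close> by (auto simp: mult_less_0_iff divide_less_0_iff)
  ultimately show False using s(2)
    by (metis mult_pos_neg not_le times_divide_eq_right)
qed

text \<open>
  Coordinates of vertices in \<open>W\<close> start at a positive value and stay positive for a while; all other
  coordinates start at zero and increase.
\<close>

lemma eventually_interior:
  assumes V: "finite V" "card V = 2 * d + 1" and W: "shrinking \<sigma> V = W" "W \<noteq> {}" and s: "\<sigma> \<noteq> 0"
  shows "eventually (\<lambda>\<epsilon>. centre W + (\<epsilon> * \<sigma>) *\<^sub>R up \<in> interior (convex hull (p ` V))) (at_right 0)"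
proof -
  have sub: "W \<subseteq> V" using W by (auto simp: shrinking_def)
  have "eventually (\<lambda>\<epsilon>. 0 < bary V t (centre W + (\<epsilon> * \<sigma>) *\<^sub>R up)) (at_right 0)" if t: "t \<in> V" for t
  proof (cases "t \<in> W")
    case True
    have "((\<lambda>\<epsilon>. 1 / real (card W) + \<epsilon> * \<sigma> / node_prod V t) \<longlongrightarrow> 1 / real (card W) + 0 * \<sigma> / node_prod V t) (at_right 0)"
      using node_prod_nonzero[OF V(1)] by (intro tendsto_intros)
    moreover have "0 < 1 / real (card W)"
      using W sub V finite_subset by (auto simp: card_gt_0_iff)
    ultimately have "eventually (\<lambda>\<epsilon>. 0 < 1 / real (card W) + \<epsilon> * \<sigma> / node_prod V t) (at_right 0)"
      using order_tendstoD(1)[of _ "1 / real (card W)" "at_right 0" 0] by simp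
    then show ?thesis using True bary_centre_up[OF V t sub W(2)] by simp
  next
    case False
    then have "0 \<le> \<sigma> * node_prod V t" using t W by (auto simp: shrinking_def)
    then have "0 < \<sigma> * node_prod V t" using s node_prod_nonzero[OF V(1)] by (simp add: order_le_less)
    then have "0 < \<sigma> / node_prod V t" by (simp add: zero_less_mult_iff zero_less_divide_iff)
    then have pos: "0 < \<epsilon> * \<sigma> / node_prod V t" if "0 < \<epsilon>" for \<epsilon> using that mult_pos_pos by fastforce
    show ?thesis
      using False bary_centre_up[OF V t sub W(2)] pos
      by (simp add: eventually_at_right_less eventually_mono[OF eventually_at_right_less])
  qed
  then have "eventually (\<lambda>\<epsilon>. \<forall>t\<in>V. 0 < bary V t (centre W + (\<epsilon> * \<sigma>) *\<^sub>R up)) (at_right 0)"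
    using V by (intro eventually_ball_finite) auto
  then show ?thesis
    by eventually_elim (auto intro!: interior_simplex_bary[OF V])
qed

lemma affine_independent_p:
  assumes V: "finite V" "card V = 2 * d + 1" and Z: "Z \<subseteq> V"
  shows "\<not> affine_dependent (p ` Z)"
proof -
  have "1 / real (card V) > 0" using V by simp
  then have "centre V \<in> interior (convex hull (p ` V))"
    using V bary_centre_up[OF V, of _ V 0] by (intro interior_simplex_bary[OF V]) force
  then have "aff_dim (convex hull (p ` V)) = DIM(real ^ 'n)"
    by (intro aff_dim_nonempty_interior) auto
  then have "aff_dim (p ` V) = int (card (p ` V)) - 1"
    unfolding card_p V(2) aff_dim_convex_hull dim by simp
  then have "\<not> affine_dependent (p ` V)" using V by (simp add: affine_independent_iff_card)
  then show ?thesis using Z by (meson affine_dependent_subset image_mono)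
qed

section \<open>Neighbourliness and Radon points\<close>

text \<open>
  The polynomial \<open>\<Prod>(x - w)\<^sup>2\<close> over \<open>w \<in> W\<close> has degree at most \<open>2 * d\<close>, is nonnegative, and vanishes
  exactly on \<open>W\<close>. Evaluating it at the barycentre of \<open>W\<close> shows that only vertices in \<open>W\<close> carry weight
  in a representation by points of \<open>V\<close>. Leaving out one factor \<open>w\<close> shows that \<open>w\<close> carries some.
\<close>

lemma neighbourly:
  assumes W: "finite W" "W \<noteq> {}" "card W \<le> d" and V: "finite V"
    and x: "centre W \<in> convex hull (p ` V)"
  shows "W \<subseteq> V"
proof (rule subsetI, rule ccontr)
  obtain u where u: "\<And>t. t \<in> V \<Longrightarrow> 0 \<le> u t" "sum u V = 1" "centre W = (\<Sum>t\<in>V. u t *\<^sub>R p t)"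
    using hull_combination[OF V x] by metis
  \<comment> \<open>The square makes the polynomial nonnegative at every node, while its degree stays at most \<open>2 * d\<close>.\<close>
  define sq where "sq A = (\<Prod>w\<in>A. [:- real w, 1:]) ^ 2" for A :: "nat set"
  have sq: "poly (sq A) y = (\<Prod>w\<in>A. y - real w) ^ 2" for A y
    by (simp add: sq_def poly_prod)
  have deg: "degree (sq A) \<le> 2 * d" if "A \<subseteq> W" for A
  proof -
    have "degree (sq A) \<le> card A * 2" unfolding sq_def
      using degree_power_le[of "\<Prod>w\<in>A. [:- real w, 1:]" 2] by (simp add: degree_prod_linear)
    also have "card A \<le> d" using card_mono[OF W(1) that] W by simp
    finally show ?thesis by simp
  qed
  have both: "(\<Sum>t\<in>V. u t * poly (sq A) (real t)) = (\<Sum>w\<in>W. (1 / real (card W)) * poly (sq A) (real w))"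
    if "A \<subseteq> W" for A
  proof -
    have "(\<Sum>w\<in>W. 1 / real (card W)) = 1" using W by simp
    then have "affine_eval (sq A) (centre W) = (\<Sum>w\<in>W. (1 / real (card W)) * poly (sq A) (real w))"
      unfolding centre_def using deg[OF that] by (intro affine_eval_moment_points)
    moreover have "affine_eval (sq A) (centre W) = (\<Sum>t\<in>V. u t * poly (sq A) (real t))"
      unfolding u(3) using deg[OF that] u(2) by (intro affine_eval_moment_points)
    ultimately show ?thesis by simp
  qed
  have "(\<Sum>w\<in>W. (1 / real (card W)) * poly (sq W) (real w)) = 0"
    using W(1) by (intro sum.neutral) (auto simp: sq)
  then have "(\<Sum>t\<in>V. u t * poly (sq W) (real t)) = 0" using both[of W] by simp
  then have "\<forall>t\<in>V. u t * poly (sq W) (real t) = 0"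
    using u(1) V by (subst (asm) sum_nonneg_eq_0_iff) (auto simp: sq)
  then have supp: "u t = 0" if "t \<in> V" "t \<notin> W" for t
    using that W(1) by (auto simp: sq)
  fix w assume w: "w \<in> W" "w \<notin> V"
  have "(\<Sum>t\<in>V. u t * poly (sq (W - {w})) (real t)) = 0"
  proof (intro sum.neutral ballI)
    fix t assume "t \<in> V"
    show "u t * poly (sq (W - {w})) (real t) = 0"
    proof (cases "t \<in> W")
      case True
      then have "t \<in> W - {w}" using w \<open>t \<in> V\<close> by auto
      then show ?thesis using W(1) by (auto simp: sq)
    qed (simp add: supp \<open>t \<in> V\<close>)
  qed
  moreover have "0 < (\<Sum>v\<in>W. (1 / real (card W)) * poly (sq (W - {w})) (real v))"
  proof (rule sum_pos2[OF W(1) w(1)])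
    show "0 < (1 / real (card W)) * poly (sq (W - {w})) (real w)"
      using W w by (simp add: sq card_gt_0_iff)
  qed (simp add: sq)
  ultimately show False using both[of "W - {w}"] by auto
qed

lemma vertex_of_simplex:
  assumes "finite V" "p t \<in> convex hull (p ` V)" shows "t \<in> V"
  using neighbourly[of "{t}" V] assms d_pos by (simp add: centre_def)

text \<open>
  For \<open>2 * d + 2\<close> nodes, the divided difference of a polynomial of degree at most \<open>2 * d\<close> vanishes. Applied
  to \<open>1\<close> and to the monomials this is an affine dependence of the points on the moment curve, and its
  coefficients alternate in sign.
\<close>

lemma radon_sum:
  assumes V: "finite V" "card V = 2 * d + 2"
  shows "(\<Sum>t\<in>V. 1 / node_prod V t) = 0" "(\<Sum>t\<in>V. (1 / node_prod V t) *\<^sub>R p t) = 0"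
proof -
  have gen: "(\<Sum>t\<in>V. poly f (real t) / node_prod V t) = 0" if "degree f \<le> 2 * d" for f
    using top_coeff_interpolation[of V f] V that by (simp add: coeff_eq_0)
  show "(\<Sum>t\<in>V. 1 / node_prod V t) = 0" using gen[of 1] by simp
  show "(\<Sum>t\<in>V. (1 / node_prod V t) *\<^sub>R p t) = 0"
  proof (rule vec_eq_iff[THEN iffD2], rule allI)
    fix i
    have deg: "degree (monom (1::real) (c i)) \<le> 2 * d" by (simp add: degree_monom_eq coord_le)
    have "(\<Sum>t\<in>V. (1 / node_prod V t) *\<^sub>R p t) $ i =
        (\<Sum>t\<in>V. poly (monom 1 (c i)) (real t) / node_prod V t)"
      unfolding sum_component by (intro sum.cong refl) (simp add: poly_monom moment_point_def)
    also have "\<dots> = 0" by (rule gen[OF deg])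
    finally show "(\<Sum>t\<in>V. (1 / node_prod V t) *\<^sub>R p t) $ i = (0 :: real ^ 'n) $ i"
      by simp
  qed
qed

text \<open>
  Moving the negative terms of the affine dependence to the other side and dividing by the sum
  \<open>N\<close> of the positive ones writes one point in two ways as a convex combination.
\<close>

lemma alternating_hulls_meet:
  assumes V: "finite V" "card V = 2 * d + 2"
  obtains z where "z \<in> rel_interior (convex hull (p ` odd_places V))"
    "z \<in> rel_interior (convex hull (p ` even_places V))"
proof -
  let ?E = "even_places V" and ?O = "odd_places V"
  define q where "q t = 1 / node_prod V t" for t
  have fin: "finite ?E" "finite ?O" using V by (auto simp: even_places_def odd_places_def)
  have parts: "V = ?E \<union> ?O" "?E \<inter> ?O = {}" by (auto simp: even_places_def odd_places_def)
  have posE: "0 < q t" if "t \<in> ?E" for t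
    using that node_prod_pos_iff[OF V(1)] by (simp add: q_def even_places_def)
  have negO: "q t < 0" if "t \<in> ?O" for t
    using that node_prod_pos_iff[OF V(1), of t] node_prod_nonzero[OF V(1), of t]
    by (auto simp: q_def odd_places_def)
  define N where "N = sum q ?E"
  have "?E \<noteq> {}" using card_even_places[OF V(1)] V(2) by auto
  then have "0 < N" unfolding N_def using fin posE by (intro sum_pos) auto
  have sumO: "sum q ?O = - N"
    using radon_sum(1)[OF V] sum.union_disjoint[OF fin parts(2), of q] parts(1)
    by (simp add: q_def N_def)
  have vecO: "(\<Sum>t\<in>?O. q t *\<^sub>R p t) = - (\<Sum>t\<in>?E. q t *\<^sub>R p t)"
    using radon_sum(2)[OF V] sum.union_disjoint[OF fin parts(2), of "\<lambda>t. q t *\<^sub>R p t"] parts(1)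
    by (simp add: q_def add_eq_0_iff)
  define z where "z = (\<Sum>t\<in>?E. (q t / N) *\<^sub>R p t)"
  have "z = (1 / N) *\<^sub>R (\<Sum>t\<in>?E. q t *\<^sub>R p t)"
    by (simp add: z_def scaleR_sum_right)
  also have "\<dots> = (- 1 / N) *\<^sub>R (\<Sum>t\<in>?O. q t *\<^sub>R p t)"
    unfolding vecO by simp
  also have "\<dots> = (\<Sum>t\<in>?O. (- q t / N) *\<^sub>R p t)"
    by (simp add: scaleR_sum_right)
  finally have zO: "z = (\<Sum>t\<in>?O. (- q t / N) *\<^sub>R p t)" .
  show thesis
  proof
    show "z \<in> rel_interior (convex hull (p ` ?O))"
      unfolding zO using fin negO \<open>0 < N\<close> sumO
      by (intro combination_in_rel_interior) (auto simp: sum_negf divide_neg_pos simp flip: sum_divide_distrib)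
    show "z \<in> rel_interior (convex hull (p ` ?E))"
      unfolding z_def using fin posE \<open>0 < N\<close>
      by (intro combination_in_rel_interior) (auto simp: N_def simp flip: sum_divide_distrib)
  qed
qed

end

section \<open>Cells of a triangulation\<close>

lemma at_right_0_witness:
  assumes "eventually P (at_right (0::real))"
  obtains \<epsilon> where "0 < \<epsilon>" "P \<epsilon>"
  using assms by (metis eventually_at_right_field dense)

locale cyclic_triangulation = moment_curve c d
  for c :: "'n::finite \<Rightarrow> nat" and d :: nat +
  fixes m :: nat and S :: "(real ^ 'n) set set"
  assumes m: "2 * d + 1 \<le> m"
    and S: "polytope_triangulation (2 * d) (cyclic_polytope c m) S"
begin

abbreviation P :: "(real ^ 'n) set" where
  "P \<equiv> cyclic_polytope c m"

definition cells :: "nat set set" where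
  "cells = {V. V \<subseteq> {1..m} \<and> card V = 2 * d + 1 \<and> convex hull (p ` V) \<in> S}"

lemma finite_S: "finite S" and Union_S: "\<Union>S = P"
  and face_S: "T \<in> S \<Longrightarrow> T' \<in> S \<Longrightarrow> T \<inter> T' face_of T"
  using S by (auto simp: polytope_triangulation_def triangulation_def)

lemma cellsD:
  assumes "V \<in> cells"
  shows "V \<subseteq> {1..m}" "finite V" "card V = 2 * d + 1" "convex hull (p ` V) \<in> S"
  using assms by (auto simp: cells_def intro: finite_subset)

lemma cell_of_simplex:
  assumes "T \<in> S"
  obtains V where "V \<in> cells" "T = convex hull (p ` V)"
proof -
  have T: "int (2 * d) simplex T" "{v. v extreme_point_of T} \<subseteq> {v. v extreme_point_of P}"
    using S assms by (auto simp: polytope_triangulation_def)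
  obtain C where C: "\<not> affine_dependent C" "int (card C) = int (2 * d) + 1" "T = convex hull C"
    using T(1) by (auto simp: simplex_def)
  have "C \<subseteq> p ` {1..m}"
  proof
    fix v assume "v \<in> C"
    then have "v extreme_point_of P"
      using T(2) C by (auto simp: extreme_point_of_convex_hull_affine_independent)
    then show "v \<in> p ` {1..m}"
      unfolding cyclic_polytope_def by (rule extreme_point_of_convex_hull)
  qed
  then obtain V where V: "V \<subseteq> {1..m}" "C = p ` V" by (auto simp: subset_image_iff)
  then have "card V = 2 * d + 1" using C(2) card_p[of V] by simp
  then have "V \<in> cells" using V C assms by (simp add: cells_def)
  then show thesis using V C that by blast
qed

text \<open>
  The intersection of the two cells is a face of \<open>T\<close> which contains a relative interior point of
  \<open>W\<close>, hence all of \<open>W\<close>; so the points of \<open>W\<close> lie in the second cell, and they are vertices of it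
  because a point \<open>p t\<close> is in the hull of finitely many such points only if it is one of them.
\<close>

lemma rel_interior_meets:
  assumes T: "T \<in> S" "V \<in> cells" and W: "convex hull (p ` W) \<subseteq> T"
    and z: "z \<in> rel_interior (convex hull (p ` W))" "z \<in> convex hull (p ` V)"
  shows "W \<subseteq> V"
proof -
  have "z \<in> T" using z(1) W rel_interior_subset by blast
  have "convex hull (p ` W) \<subseteq> T \<inter> convex hull (p ` V)"
  proof (rule subset_of_face_of[OF face_S[OF T(1) cellsD(4)[OF T(2)]] W])
    show "T \<inter> convex hull (p ` V) \<inter> rel_interior (convex hull (p ` W)) \<noteq> {}"
      using z \<open>z \<in> T\<close> by blast
  qed
  then have "p w \<in> convex hull (p ` V)" if "w \<in> W" for w
    using that hull_inc[of "p w" "p ` W" convex] by blast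
  then show ?thesis using vertex_of_simplex cellsD(2)[OF T(2)] by blast
qed

text \<open>
  Both cells contain the same interior point, close to the barycentre of their shrinking vertices.
\<close>

lemma shrinking_determines_cell:
  assumes V: "V \<in> cells" "V' \<in> cells" and shrinking: "shrinking \<sigma> V = shrinking \<sigma> V'" "shrinking \<sigma> V \<noteq> {}" and s: "\<sigma> \<noteq> 0"
  shows "V = V'"
proof -
  let ?x = "\<lambda>\<epsilon>. centre (shrinking \<sigma> V) + (\<epsilon> * \<sigma>) *\<^sub>R up"
  have "eventually (\<lambda>\<epsilon>. ?x \<epsilon> \<in> interior (convex hull (p ` V))) (at_right 0)"
    using eventually_interior[OF cellsD(2,3)[OF V(1)] refl shrinking(2) s] .
  moreover have "eventually (\<lambda>\<epsilon>. ?x \<epsilon> \<in> interior (convex hull (p ` V'))) (at_right 0)"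
    using eventually_interior[OF cellsD(2,3)[OF V(2)] shrinking(1)[symmetric] shrinking(2) s] .
  ultimately have "eventually (\<lambda>\<epsilon>. ?x \<epsilon> \<in> interior (convex hull (p ` V)) \<inter> interior (convex hull (p ` V'))) (at_right 0)"
    by eventually_elim auto
  then obtain y where y: "y \<in> interior (convex hull (p ` V))" "y \<in> interior (convex hull (p ` V'))"
    using at_right_0_witness by (metis (no_types, lifting) IntE)
  have ri: "interior A \<subseteq> rel_interior A" for A :: "(real ^ 'n) set"
    by (rule interior_subset_rel_interior)
  have "V \<subseteq> V'"
    using rel_interior_meets[OF cellsD(4)[OF V(1)] V(2) order_refl, of y] y ri interior_subset by blast
  moreover have "V' \<subseteq> V"
    using rel_interior_meets[OF cellsD(4)[OF V(2)] V(1) order_refl, of y] y ri interior_subset by blast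
  ultimately show ?thesis by blast
qed

text \<open>
  The simplex \<open>V\<close> serves only to show that the barycentre of \<open>W\<close> can be moved in the given direction inside
  the polytope. The moved point lies in some cell, and as there are finitely many cells, all closed,
  this cell also contains the barycentre itself if the move is short enough.
\<close>

lemma cell_in_direction:
  assumes V: "V \<subseteq> {1..m}" "card V = 2 * d + 1" and W: "shrinking \<sigma> V = W" "W \<noteq> {}" and s: "\<sigma> \<noteq> 0"
    and vertices: "\<And>U. U \<in> cells \<Longrightarrow> centre W \<in> convex hull (p ` U) \<Longrightarrow> W \<subseteq> U"
  obtains U where "U \<in> cells" "shrinking \<sigma> U \<subseteq> W"
proof -
  let ?x = "\<lambda>\<epsilon>. centre W + (\<epsilon> * \<sigma>) *\<^sub>R up"
  have finV: "finite V" using V finite_subset by blast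
  have "eventually (\<lambda>\<epsilon>. ?x \<epsilon> \<in> P) (at_right 0)"
    using eventually_interior[OF finV V(2) W s]
  proof eventually_elim
    case (elim \<epsilon>)
    moreover have "convex hull (p ` V) \<subseteq> P"
      unfolding cyclic_polytope_def using V by (intro hull_mono image_mono)
    ultimately show ?case using interior_subset by blast
  qed
  \<comment> \<open>A cell without the barycentre of \<open>W\<close> is closed, so short moves do not reach it.\<close>
  moreover have "eventually (\<lambda>\<epsilon>. \<forall>T\<in>S. centre W \<notin> T \<longrightarrow> ?x \<epsilon> \<notin> T) (at_right 0)"
  proof (intro eventually_ball_finite finite_S ballI)
    fix T assume "T \<in> S"
    show "eventually (\<lambda>\<epsilon>. centre W \<notin> T \<longrightarrow> ?x \<epsilon> \<notin> T) (at_right 0)"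
    proof (cases "centre W \<in> T")
      case False
      obtain U where "U \<in> cells" "T = convex hull (p ` U)"
        using cell_of_simplex[OF \<open>T \<in> S\<close>] .
      then have "closed T"
        using cellsD(2) by (simp add: compact_imp_closed finite_imp_compact_convex_hull)
      moreover have "(?x \<longlongrightarrow> centre W + (0 * \<sigma>) *\<^sub>R up) (at_right 0)"
        by (intro tendsto_intros)
      ultimately have "eventually (\<lambda>\<epsilon>. ?x \<epsilon> \<in> - T) (at_right 0)"
        using False by (intro topological_tendstoD) auto
      then show ?thesis by eventually_elim auto
    qed simp
  qed
  ultimately have "eventually (\<lambda>\<epsilon>. ?x \<epsilon> \<in> P \<and> (\<forall>T\<in>S. centre W \<notin> T \<longrightarrow> ?x \<epsilon> \<notin> T)) (at_right 0)"
    by (rule eventually_conj)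
  then obtain \<epsilon> where \<epsilon>: "0 < \<epsilon>" "?x \<epsilon> \<in> P" "\<forall>T\<in>S. centre W \<notin> T \<longrightarrow> ?x \<epsilon> \<notin> T"
    using at_right_0_witness by (metis (no_types, lifting))
  then obtain T where T: "T \<in> S" "?x \<epsilon> \<in> T" "centre W \<in> T" using Union_S by blast
  obtain U where U: "U \<in> cells" "T = convex hull (p ` U)" using cell_of_simplex[OF T(1)] .
  have "W \<subseteq> U" using vertices U T by blast
  then have "shrinking \<sigma> U \<subseteq> W"
    using shrinking_subset[OF cellsD(2,3)[OF U(1)] _ W(2) s \<epsilon>(1)] T U by blast
  then show thesis using U that by blast
qed

lemma card_odd_cell: "V \<in> cells \<Longrightarrow> card (odd_places V) = d"
  and card_even_cell: "V \<in> cells \<Longrightarrow> card (even_places V) = d + 1"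
  using cellsD by (simp_all add: card_odd_places card_even_places)

text \<open>
  Surjectivity combines a simplex with the prescribed odd places, which makes room above the
  barycentre, with neighbourliness, which makes \<open>W\<close> a face of every cell around its barycentre.
\<close>

lemma odd_places_bij:
  "bij_betw odd_places cells {W. W \<subseteq> {2..<m} \<and> card W = d \<and> separated W}"
proof (rule bij_betwI')
  fix V V' assume V: "V \<in> cells" "V' \<in> cells"
  have "odd_places V \<noteq> {}" using card_odd_cell[OF V(1)] d_pos by auto
  then show "odd_places V = odd_places V' \<longleftrightarrow> V = V'"
    using shrinking_determines_cell[OF V, of 1] V cellsD(2) by (auto simp: shrinking_up)
next
  fix V assume V: "V \<in> cells"
  then show "odd_places V \<in> {W. W \<subseteq> {2..<m} \<and> card W = d \<and> separated W}"
    using odd_places_inner[of V m] separated_odd_places[of V] card_odd_cell cellsD by auto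
next
  fix W assume "W \<in> {W. W \<subseteq> {2..<m} \<and> card W = d \<and> separated W}"
  then have W: "W \<subseteq> {2..<m}" "card W = d" "separated W" by auto
  have finW: "finite W" "W \<noteq> {}" using W d_pos finite_subset by auto
  obtain V where V: "V \<subseteq> {1..m}" "card V = 2 * card W + 1" "odd_places V = W"
    using odd_places_realised[OF W(1,3)] m by auto
  have "shrinking 1 V = W" using V shrinking_up finite_subset by blast
  then obtain U where U: "U \<in> cells" "shrinking 1 U \<subseteq> W"
    using cell_in_direction[of V 1 W] V W finW neighbourly[of W] cellsD(2) by auto
  then have "odd_places U \<subseteq> W" using shrinking_up cellsD(2) by blast
  then have "odd_places U = W"
    using card_subset_eq[OF finW(1)] card_odd_cell[OF U(1)] W(2) by metis
  then show "\<exists>U\<in>cells. W = odd_places U" using U by blast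
qed

lemma card_cells: "card cells = (m - d - 1) choose d"
proof -
  have "card cells = card {W. W \<subseteq> {2..<m} \<and> card W = d \<and> separated W}"
    using odd_places_bij by (rule bij_betw_same_card)
  also have "\<dots> = (m - 2 + 1 - d) choose d"
  proof -
    have "m - 2 + 2 = m" using m d_pos by linarith
    then show ?thesis using card_separated_subsets[of "m - 2" d] by (simp only:)
  qed
  also have "m - 2 + 1 - d = m - d - 1" using m d_pos by simp
  finally show ?thesis .
qed

lemma aff_dim_P: "aff_dim P = 2 * int d"
proof -
  have "p ` {1..2 * d + 1} \<subseteq> P"
    unfolding cyclic_polytope_def using m by (auto intro: hull_inc)
  then have "aff_dim (p ` {1..2 * d + 1}) \<le> aff_dim P" by (rule aff_dim_subset)
  moreover have "aff_dim (p ` {1..2 * d + 1}) = 2 * int d"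
    using aff_dim_affine_independent[OF affine_independent_p[of "{1..2 * d + 1}" "{1..2 * d + 1}"]]
    unfolding card_p by simp
  moreover have "aff_dim P \<le> 2 * int d"
    using aff_dim_le_DIM[of P] dim by simp
  ultimately show ?thesis by linarith
qed

text \<open>
  Cover \<open>X\<close> by \<open>d\<close> disjoint pairs \<open>{r, Suc r}\<close>. The polynomial \<open>\<Prod>(x - r) (x - r - 1)\<close> is
  nonnegative at all integers, so it defines a face of the polytope, which contains \<open>2 * d\<close> affinely
  independent points. Its leading coefficient is \<open>1\<close>, so it decreases strictly when moving downwards, and the
  face is a lower one.
\<close>

lemma pair_in_lower_facet:
  assumes X: "X \<subseteq> {1..m}" "card X \<le> d + 1" "r \<in> X" "Suc r \<in> X"
  obtains F where "lower_facet c (2 * d) P F" "convex hull (p ` X) \<subseteq> F"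
proof -
  obtain R where R: "card R = d" "R \<inter> Suc ` R = {}" "X \<subseteq> R \<union> Suc ` R" "R \<union> Suc ` R \<subseteq> {1..m}"
    using cover_by_pairs[of X m d] X m by auto
  have finR: "finite R" using R(4) finite_subset by blast
  define Z where "Z = R \<union> Suc ` R"
  have cardZ: "card Z = 2 * d"
    unfolding Z_def using R finR by (simp add: card_Un_disjoint card_image)
  define f where "f = (\<Prod>r\<in>R. [:- real r, 1:]) * (\<Prod>r\<in>Suc ` R. [:- real r, 1:])"
  have cards: "card (Suc ` R) = d" using R by (simp add: card_image)
  have nz: "(\<Prod>r\<in>A. [:- real r, 1:]) \<noteq> 0" if "finite A" for A using that by auto
  have deg: "degree f = 2 * d"
    unfolding f_def using finR nz by (subst degree_mult_eq) (simp_all add: degree_prod_linear cards R)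
  have lead: "coeff f (2 * d) = 1"
    using lead_coeff_mult[of "\<Prod>r\<in>R. [:- real r, 1:]" "\<Prod>r\<in>Suc ` R. [:- real r, 1:]"]
      coeff_prod_linear[of R] coeff_prod_linear[of "Suc ` R"]
    by (simp add: degree_prod_linear cards R deg flip: f_def)
  have poly_f: "poly f (real t) = (\<Prod>r\<in>R. (real t - real r) * (real t - real (Suc r)))" for t
  proof -
    have "poly f (real t) = (\<Prod>r\<in>R. real t - real r) * (\<Prod>r\<in>Suc ` R. real t - real r)"
      by (simp add: f_def poly_prod)
    then show ?thesis by (simp only: prod.distrib prod.reindex inj_Suc o_def)
  qed
  have "0 \<le> poly f (real t)" for t
    unfolding poly_f
  proof (intro prod_nonneg)
    fix r
    show "0 \<le> (real t - real r) * (real t - real (Suc r))"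
    proof (cases "t \<le> r")
      case True
      then show ?thesis by (intro mult_nonpos_nonpos) auto
    next
      case False
      then show ?thesis by (intro mult_nonneg_nonneg) auto
    qed
  qed
  then have nonneg: "0 \<le> affine_eval f x" if "x \<in> P" for x
    using affine_eval_nonneg[of f "{1..m}" x] that deg by (simp add: cyclic_polytope_def)
  have zero: "affine_eval f (p t) = 0" if "t \<in> Z" for t
    using that finR deg by (auto simp: affine_eval_moment_point poly_f Z_def)
  define F where "F = P \<inter> {x. affine_eval f x = 0}"
  have convP: "convex P" by (simp add: cyclic_polytope_def)
  have face: "F face_of P"
  proof -
    have "F = P \<inter> {x. (\<chi> i. coeff f (c i)) \<bullet> x = - coeff f 0}"
      by (auto simp: F_def affine_eval_def)
    moreover have "(\<chi> i. coeff f (c i)) \<bullet> x \<ge> - coeff f 0" if "x \<in> P" for x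
      using nonneg[OF that] by (simp add: affine_eval_def)
    ultimately show ?thesis
      using face_of_Int_supporting_hyperplane_ge[OF convP] by simp
  qed
  have ZF: "p ` Z \<subseteq> F"
  proof (rule image_subsetI)
    fix t assume t: "t \<in> Z"
    then have "t \<in> {1..m}" using R(4) unfolding Z_def by blast
    then have "p t \<in> P" unfolding cyclic_polytope_def by (intro hull_inc imageI)
    then show "p t \<in> F" using zero[OF t] by (simp add: F_def)
  qed
  have drop: "y \<notin> P" if "x \<in> F" "below c (2 * d) y x" for x y
  proof
    assume "y \<in> P"
    have "2 * d \<in> range c" using bij_betw_imp_surj_on[OF coords] d_pos by simp
    then obtain i where i: "c i = 2 * d" by auto
    have c_i: "c j = 2 * d \<longleftrightarrow> j = i" for j
      using bij_betw_imp_inj_on[OF coords] i by (metis UNIV_I inj_onD)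
    have "y = x + (y $ i - x $ i) *\<^sub>R up"
      using that(2) by (auto simp: vec_eq_iff up_def below_def c_i)
    then have "affine_eval f y = affine_eval f x + (y $ i - x $ i) * coeff f (2 * d)"
      using affine_eval_up by metis
    moreover have "y $ i < x $ i" using that(2) i by (auto simp: below_def)
    ultimately show False using lead that(1) nonneg[OF \<open>y \<in> P\<close>] by (simp add: F_def)
  qed
  \<comment> \<open>Any further node completes \<open>Z\<close> to the vertex set of a full-dimensional simplex.\<close>
  have "Suc m \<notin> Z" "finite Z" using R(4) finR by (auto simp: Z_def)
  then have "\<not> affine_dependent (p ` Z)"
    using affine_independent_p[of "insert (Suc m) Z" Z] cardZ by auto
  then have "aff_dim (p ` Z) = 2 * int d - 1"
    using aff_dim_affine_independent cardZ by (fastforce simp: card_p)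
  then have "2 * int d - 1 \<le> aff_dim F" using aff_dim_subset[OF ZF] by simp
  moreover have "aff_dim F < aff_dim P"
  proof (rule face_of_aff_dim_lt[OF convP face])
    have "\<exists>t\<in>{1..m}. t \<notin> Z"
    proof (rule ccontr)
      assume "\<not> ?thesis"
      then have "card {1..m} \<le> card Z" using \<open>finite Z\<close> by (intro card_mono) auto
      then show False using m cardZ by simp
    qed
    then obtain t where t: "t \<in> {1..m}" "t \<notin> Z" by blast
    have "poly f (real t) \<noteq> 0"
      using t(2) finR by (auto simp: poly_f Z_def simp flip: of_nat_Suc)
    then have "p t \<notin> F" using deg by (simp add: F_def affine_eval_moment_point)
    moreover have "p t \<in> P" using t(1) unfolding cyclic_polytope_def by (intro hull_inc imageI)
    ultimately show "F \<noteq> P" by blast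
  qed
  ultimately have "aff_dim F = aff_dim P - 1" by (simp add: aff_dim_P)
  moreover have "F \<noteq> {}" using ZF cardZ d_pos by auto
  ultimately have "lower_facet c (2 * d) P F" using face drop by (auto simp: lower_facet_def facet_of_def)
  moreover have "convex hull (p ` X) \<subseteq> F"
    using ZF R(3) face_of_imp_convex[OF face] unfolding Z_def by (intro hull_minimal) blast+
  ultimately show thesis using that by blast
qed

text \<open>
  The set \<open>e(S)\<close>, with index sets in place of increasing tuples.
\<close>

definition non_lower_faces :: "nat set set" where
  "non_lower_faces = {W. W \<subseteq> {1..m} \<and> card W = d + 1 \<and>
     (\<exists>T\<in>S. convex hull (p ` W) face_of T) \<and>
     \<not> (\<exists>F. lower_facet c (2 * d) P F \<and> convex hull (p ` W) \<subseteq> F)}"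

lemma separated_non_lower_face:
  assumes W: "W \<in> non_lower_faces" shows "separated W"
  unfolding separated_def
proof (intro ballI notI)
  fix r assume r: "r \<in> W" "Suc r \<in> W"
  have "W \<subseteq> {1..m}" "card W \<le> d + 1" using W by (auto simp: non_lower_faces_def)
  then obtain F where "lower_facet c (2 * d) P F" "convex hull (p ` W) \<subseteq> F"
    using pair_in_lower_facet r by blast
  then show False using W by (auto simp: non_lower_faces_def)
qed

lemma non_lower_face_vertices:
  assumes W: "W \<in> non_lower_faces" and V: "V \<in> cells"
    and z: "z \<in> rel_interior (convex hull (p ` W))" "z \<in> convex hull (p ` V)"
  shows "W \<subseteq> V"
proof -
  obtain T where "T \<in> S" "convex hull (p ` W) face_of T" using W by (auto simp: non_lower_faces_def)
  then show ?thesis using rel_interior_meets[OF _ V _ z] face_of_imp_subset by blast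
qed

text \<open>
  The barycentre can be moved downwards inside the cell, but from a point of a lower facet
  every move downwards leaves the polytope.
\<close>

lemma even_places_non_lower_face:
  assumes V: "V \<in> cells" shows "even_places V \<in> non_lower_faces"
proof -
  let ?W = "even_places V"
  have sub: "?W \<subseteq> V" by (auto simp: even_places_def)
  have ne: "?W \<noteq> {}" "finite ?W" using card_even_cell[OF V] card.infinite by force+
  have "convex hull (p ` ?W) face_of convex hull (p ` V)"
    unfolding face_of_convex_hull_affine_independent[OF affine_independent_p[OF cellsD(2,3)[OF V] order_refl]]
    by (intro exI[of _ "p ` ?W"] conjI image_mono sub refl)
  then have face: "\<exists>T\<in>S. convex hull (p ` ?W) face_of T" using cellsD(4)[OF V] by blast
  have "\<not> lower_facet c (2 * d) P F" if F: "convex hull (p ` ?W) \<subseteq> F" for F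
  proof
    assume lf: "lower_facet c (2 * d) P F"
    have ev: "eventually (\<lambda>\<epsilon>. centre ?W + (\<epsilon> * (-1)) *\<^sub>R up \<in> interior (convex hull (p ` V))) (at_right 0)"
      using eventually_interior[OF cellsD(2,3)[OF V] shrinking_down[OF cellsD(2)[OF V]] ne(1)] by simp
    obtain \<epsilon> where \<epsilon>: "0 < \<epsilon>" "centre ?W + (\<epsilon> * (-1)) *\<^sub>R up \<in> interior (convex hull (p ` V))"
      by (rule at_right_0_witness[OF ev])
    have "convex hull (p ` V) \<subseteq> P" using cellsD(4)[OF V] Union_S by blast
    then have "centre ?W + (\<epsilon> * (-1)) *\<^sub>R up \<in> P" using \<epsilon> interior_subset by blast
    moreover have "centre ?W \<in> F" using centre_in_rel_interior[OF ne(2,1)] rel_interior_subset F by blast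
    moreover have "below c (2 * d) (centre ?W + (\<epsilon> * (-1)) *\<^sub>R up) (centre ?W)"
      using \<epsilon>(1) by (simp add: below_def up_def)
    ultimately show False using lf by (auto simp: lower_facet_def)
  qed
  then show ?thesis
    using face sub cellsD(1)[OF V] card_even_cell[OF V] by (auto simp: non_lower_faces_def)
qed

text \<open>
  For surjectivity, an element of \<open>e(S)\<close> has no adjacent elements, so a simplex with these even places
  makes room below its barycentre.
\<close>

lemma even_places_bij: "bij_betw even_places cells non_lower_faces"
proof (rule bij_betwI')
  fix V V' assume V: "V \<in> cells" "V' \<in> cells"
  have "even_places V \<noteq> {}" using card_even_cell[OF V(1)] by auto
  then show "even_places V = even_places V' \<longleftrightarrow> V = V'"
    using shrinking_determines_cell[OF V, of "-1"] V cellsD(2) by (auto simp: shrinking_down)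
next
  fix W assume W: "W \<in> non_lower_faces"
  then have W': "W \<subseteq> {1..m}" "card W = d + 1" by (auto simp: non_lower_faces_def)
  have finW: "finite W" "W \<noteq> {}" using W' finite_subset by auto
  obtain V where V: "V \<subseteq> {1..m}" "card V + 1 = 2 * card W" "even_places V = W"
    using even_places_realised[OF W'(1) separated_non_lower_face[OF W] finW(2)] .
  have "shrinking (-1) V = W" using V shrinking_down finite_subset by blast
  moreover have "card V = 2 * d + 1" using V W' by simp
  ultimately obtain U where U: "U \<in> cells" "shrinking (-1) U \<subseteq> W"
    using cell_in_direction[of V "-1" W] V(1) finW non_lower_face_vertices[OF W _ centre_in_rel_interior[OF finW]]
    by (metis neg_equal_0_iff_equal zero_neq_one)
  then have "even_places U \<subseteq> W" using shrinking_down cellsD(2) by blast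
  then have "even_places U = W"
    using card_subset_eq[OF finW(1)] card_even_cell[OF U(1)] W'(2) by metis
  then show "\<exists>U\<in>cells. W = even_places U" using U by blast
qed (rule even_places_non_lower_face)

text \<open>
  The common relative interior point forces both simplices into the same cell, which would then
  have at least \<open>2 * d + 2\<close> vertices.
\<close>

lemma non_lower_faces_not_alternating:
  assumes X: "X \<in> non_lower_faces" "Y \<in> non_lower_faces" and V: "finite V" "card V = 2 * d + 2"
    and alt: "odd_places V = X" "even_places V = Y"
  shows False
proof -
  obtain z where z: "z \<in> rel_interior (convex hull (p ` X))" "z \<in> rel_interior (convex hull (p ` Y))"
    using alternating_hulls_meet[OF V] alt by metis
  obtain T where T: "T \<in> S" "convex hull (p ` X) face_of T" using X by (auto simp: non_lower_faces_def)
  obtain U where U: "U \<in> cells" "T = convex hull (p ` U)" using cell_of_simplex[OF T(1)] .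
  have "z \<in> T" using z(1) T(2) face_of_imp_subset rel_interior_subset by blast
  then have "X \<subseteq> U" "Y \<subseteq> U" using non_lower_face_vertices U z X by auto
  then have "V \<subseteq> U" using alt by (auto simp: odd_places_def even_places_def)
  then have "card V \<le> card U" using card_mono cellsD(2)[OF U(1)] by blast
  then show False using V cellsD(3)[OF U(1)] by simp
qed

end

section \<open>Increasing tuples\<close>

lemma sorted_nth_less_iff:
  assumes "sorted_wrt (<) (xs :: nat list)" "i < length xs" "j < length xs"
  shows "xs ! i < xs ! j \<longleftrightarrow> i < j"
  using sorted_wrt_nth_less[OF assms(1), of i j] sorted_wrt_nth_less[OF assms(1), of j i] assms(2,3)
  by (cases i j rule: linorder_cases) auto

lemma card_indices:
  assumes "sorted_wrt (<) (xs :: nat list)"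
  shows "card {x \<in> set xs. Q x} = card {i. i < length xs \<and> Q (xs ! i)}"
proof -
  have "{x \<in> set xs. Q x} = (!) xs ` {i. i < length xs \<and> Q (xs ! i)}"
    by (auto simp: in_set_conv_nth)
  moreover have "inj_on ((!) xs) {i. i < length xs \<and> Q (xs ! i)}"
    using assms by (auto simp: inj_on_def nth_eq_iff_index_eq strict_sorted_iff)
  ultimately show ?thesis by (simp add: card_image)
qed

text \<open>
  Above \<open>X ! j\<close> there are \<open>d - j\<close> entries of \<open>X\<close> and \<open>d - j + 1\<close> entries of \<open>Y\<close>, above \<open>Y ! j\<close> there are
  \<open>d - j\<close> of each.
\<close>

lemma intertwines_alternating:
  assumes X: "X \<in> increasing_tuples d m" and Y: "Y \<in> increasing_tuples d m"
    and XY: "intertwines d X Y"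
  shows "card (set X \<union> set Y) = 2 * d + 2"
    "odd_places (set X \<union> set Y) = set X" "even_places (set X \<union> set Y) = set Y"
proof -
  have lenX: "length X = Suc d" "sorted_wrt (<) X" and lenY: "length Y = Suc d" "sorted_wrt (<) Y"
    using X Y by (auto simp: increasing_tuples_def)
  have XX: "X ! i < X ! j \<longleftrightarrow> i < j" and YY: "Y ! i < Y ! j \<longleftrightarrow> i < j" if "i \<le> d" "j \<le> d" for i j
    using that lenX lenY by (simp_all add: sorted_nth_less_iff)
  have lt: "X ! i < Y ! j" if "i \<le> j" "j \<le> d" for i j
  proof -
    have "X ! i \<le> X ! j" using XX[of j i] that by (simp add: not_less[symmetric])
    also have "X ! j < Y ! j" using XY that by (simp add: intertwines_def)
    finally show ?thesis .
  qed
  have gt: "Y ! j < X ! i" if "j < i" "i \<le> d" for i j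
  proof -
    have "Y ! j < X ! (j + 1)" using XY that by (simp add: intertwines_def)
    also have "X ! (j + 1) \<le> X ! i" using XX[of i "j + 1"] that by (simp add: not_less[symmetric])
    finally show ?thesis .
  qed
  have XY_iff: "X ! i < Y ! j \<longleftrightarrow> i \<le> j" and YX_iff: "Y ! j < X ! i \<longleftrightarrow> j < i"
    and neq: "X ! i \<noteq> Y ! j" if "i \<le> d" "j \<le> d" for i j
    using lt[of i j] gt[of j i] that by (metis leI less_asym, metis leI less_asym, metis leI less_irrefl)
  have disj: "set X \<inter> set Y = {}"
    using neq lenX lenY by (fastforce simp: in_set_conv_nth less_Suc_eq_le disjoint_iff)
  have "distinct X" "distinct Y" using lenX lenY by (simp_all add: strict_sorted_iff)
  then show "card (set X \<union> set Y) = 2 * d + 2"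
    using disj lenX lenY by (simp add: card_Un_disjoint distinct_card)
  have split: "above (set X \<union> set Y) t =
      card {i. i < Suc d \<and> t < X ! i} + card {i. i < Suc d \<and> t < Y ! i}" for t
  proof -
    have "{s \<in> set X \<union> set Y. t < s} = {s \<in> set X. t < s} \<union> {s \<in> set Y. t < s}" by auto
    moreover have "{s \<in> set X. t < s} \<inter> {s \<in> set Y. t < s} = {}" using disj by auto
    ultimately show ?thesis
      by (simp add: above_def card_Un_disjoint card_indices lenX lenY)
  qed
  have above_X: "odd (above (set X \<union> set Y) (X ! j))" if "j \<le> d" for j
  proof -
    have "{i. i < Suc d \<and> X ! j < X ! i} = {j<..d}" "{i. i < Suc d \<and> X ! j < Y ! i} = {j..d}"
      using that XX XY_iff by (auto simp: less_Suc_eq_le)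
    then have "above (set X \<union> set Y) (X ! j) = (d - j) + Suc (d - j)"
      using that by (simp add: split Suc_diff_le)
    then show ?thesis by simp
  qed
  have above_Y: "even (above (set X \<union> set Y) (Y ! j))" if "j \<le> d" for j
  proof -
    have "{i. i < Suc d \<and> Y ! j < X ! i} = {j<..d}" "{i. i < Suc d \<and> Y ! j < Y ! i} = {j<..d}"
      using that YY YX_iff by (auto simp: less_Suc_eq_le)
    then show ?thesis by (simp add: split)
  qed
  have "odd (above (set X \<union> set Y) x)" if "x \<in> set X" for x
    using that above_X lenX by (auto simp: in_set_conv_nth less_Suc_eq_le)
  moreover have "even (above (set X \<union> set Y) y)" if "y \<in> set Y" for y
    using that above_Y lenY by (auto simp: in_set_conv_nth less_Suc_eq_le)
  ultimately show "odd_places (set X \<union> set Y) = set X" "even_places (set X \<union> set Y) = set Y"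
    by (auto simp: odd_places_def even_places_def)
qed

lemma bij_increasing_tuples:
  "bij_betw set (increasing_tuples d m) {W. W \<subseteq> {1..m} \<and> card W = d + 1}"
proof (rule bij_betwI')
  fix xs ys assume "xs \<in> increasing_tuples d m" "ys \<in> increasing_tuples d m"
  then show "set xs = set ys \<longleftrightarrow> xs = ys"
    by (auto simp: increasing_tuples_def strict_sorted_equal)
next
  fix xs assume "xs \<in> increasing_tuples d m"
  then show "set xs \<in> {W. W \<subseteq> {1..m} \<and> card W = d + 1}"
    by (auto simp: increasing_tuples_def strict_sorted_iff distinct_card)
next
  fix W assume "W \<in> {W. W \<subseteq> {1..m} \<and> card W = d + 1}"
  then show "\<exists>xs\<in>increasing_tuples d m. W = set xs"
    using finite_subset[of W "{1..m}"]
    by (intro bexI[of _ "sorted_list_of_set W"]) (auto simp: increasing_tuples_def)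
qed

lemma separated_tuple:
  assumes xs: "xs \<in> increasing_tuples d m" and sep: "separated (set xs)"
  shows "xs \<in> I_tuples d m"
proof -
  have len: "length xs = d + 1" "sorted_wrt (<) xs" using xs by (auto simp: increasing_tuples_def)
  have "xs ! j + 2 \<le> xs ! (j + 1)" if "j < d" for j
  proof -
    have "xs ! j < xs ! (j + 1)" using len that by (simp add: sorted_nth_less_iff)
    moreover have "Suc (xs ! j) \<noteq> xs ! (j + 1)"
      using sep len that by (metis add_less_cancel_right less_add_one nth_mem order_less_trans separated_def)
    ultimately show ?thesis by simp
  qed
  then show ?thesis using xs by (auto simp: I_tuples_def increasing_tuples_def)
qed

theorem theorem2p3:
  fixes d m :: nat
    and c :: "'n::finite \<Rightarrow> nat"
    and S :: "(real ^ 'n) set set"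
  assumes "d \<ge> 1"
    and "m \<ge> 2 * d + 1"
    and "bij_betw c UNIV {1..2 * d}"
    and "polytope_triangulation (2 * d) (cyclic_polytope c m) S"
  shows "e_simplices c d m S \<subseteq> I_tuples d m \<and>
         card (e_simplices c d m S) = (m - d - 1) choose d \<and>
         non_intertwining d (e_simplices c d m S)"
proof -
  interpret cyclic_triangulation c d m S
    using assms by unfold_locales auto
  let ?e = "e_simplices c d m S"
  have e: "?e = {xs \<in> increasing_tuples d m. set xs \<in> non_lower_faces}"
    using bij_betwE[OF bij_increasing_tuples[of d m]] by (auto simp: e_simplices_def non_lower_faces_def)
  have "set ` ?e = set ` increasing_tuples d m \<inter> non_lower_faces" unfolding e by blast
  also have "\<dots> = non_lower_faces"
    unfolding bij_betw_imp_surj_on[OF bij_increasing_tuples] by (auto simp: non_lower_faces_def)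
  finally have "bij_betw set ?e non_lower_faces"
    by (intro bij_betw_subset[OF bij_increasing_tuples[of d m]]) (auto simp: e)
  then have "card ?e = card non_lower_faces" by (rule bij_betw_same_card)
  also have "\<dots> = card cells" using bij_betw_same_card[OF even_places_bij] by simp
  finally have "card ?e = (m - d - 1) choose d" by (simp only: card_cells)
  moreover have "?e \<subseteq> I_tuples d m"
    using separated_tuple separated_non_lower_face by (auto simp: e)
  moreover have "non_intertwining d ?e"
    unfolding non_intertwining_def
  proof (intro ballI notI)
    fix X Y assume "X \<in> ?e" "Y \<in> ?e" "intertwines d X Y"
    then show False
      using non_lower_faces_not_alternating[of "set X" "set Y" "set X \<union> set Y"] intertwines_alternating[of X d m Y]
      by (simp add: e)
  qed
  ultimately show ?thesis by blast
qed

end
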